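(* Let $\alpha>-1$ be fixed and consider the Gaussian $\beta$-ensemble with weight $e^{-\lambda^2/2}$ and $\beta=2\alpha/N$. Let $m^{\rm G}_{2p,0}$, $m^{\rm G}_{2p,1}$ be the leading and first-correction moments and let $\tilde\mu^{\rm G}_{2p,0}$ be the summed leading covariances, all as defined in the context. Then for all integers $p\ge 0$, $$m_{2(p+1),1}^{\rm G} = -\alpha(2p+1)\,m_{2p,0}^{\rm G} + (2p+1)\,m_{2p,1}^{\rm G} + \alpha\,\tilde\mu_{2p,0}^{\rm G} + 2\alpha\sum_{s=0}^{p-1} m_{2s,0}^{\rm G}\, m_{2(p-s),1}^{\rm G},\qquad m_{0,1}^{\rm G}=0,$$ where $\{m^{\rm G}_{2p,0}\}$ is determined by the recurrence $$m_{2p+2,0}^{\rm G} = (2p+1)\,m_{2p,0}^{\rm G} + \alpha\sum_{s=0}^{p} m_{2p-2s,0}^{\rm G}\, m_{2s,0}^{\rm G}\quad(p\ge 0),\qquad m_{0,0}^{\rm G}=1,$$ and $\{\tilde\mu^{\rm G}_{2p,0}\}$ is determined by the recurrence $$\tilde\mu_{2p+2,0}^{\rm G} = (p+1)\,\tilde\mu_{2p,0}^{\rm G} + (2p+1)(p+1)\,m_{2p,0}^{\rm G} + 2\alpha\sum_{l=1}^{p}\tilde\mu_{2l,0}^{\rm G}\, m_{2(p-l),0}^{\rm G}\quad(p\ge 0),\qquad \tilde\mu_{0,0}^{\rm G}=0.$$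
   Context: The Gaussian $\beta$-ensemble is the probability density on $\mathbb R^N$ proportional to $\prod_{l=1}^N e^{-\lambda_l^2/2}\prod_{1\le j<k\le N}|\lambda_k-\lambda_j|^\beta$. Here $\beta=2\alpha/N$ with $\alpha>-1$ fixed, and $N\to\infty$. Standing assumption (large-$N$ ansatz): for every $n\ge1$ and all integers $p_1,\dots,p_n\ge 0$, the joint cumulant of the random variables $\sum_j\lambda_j^{p_1},\dots,\sum_j\lambda_j^{p_n}$ (with $\beta=2\alpha/N$) has, as $N\to\infty$, an asymptotic expansion of the form $N\sum_{l\ge0}c^{(l)}_{p_1,\dots,p_n}N^{-l}$ with coefficients independent of $N$. Definitions: $m^{\rm G}_{p,0}$ and $m^{\rm G}_{p,1}$ are defined by $\frac1N\big\langle\sum_{j=1}^N\lambda_j^p\big\rangle=m^{\rm G}_{p,0}+\frac1N m^{\rm G}_{p,1}+O(N^{-2})$; $\mu^{\rm G}_{(p,q),0}=\lim_{N\to\infty}\frac1N{\rm Cov}\big(\sum_i\lambda_i^p,\sum_i\lambda_i^q\big)$; and $\tilde\mu^{\rm G}_{2p,0}=\sum_{p_1+q_1=2p,\;p_1,q_1\ge0}\mu^{\rm G}_{(p_1,q_1),0}$. Empty sums are zero. *)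

theory Defs
  imports "HOL-Probability.Probability" "HOL-Library.Landau_Symbols" "HOL-Library.Disjoint_Sets"
begin

(* Points of R^N are functions on the index set {..<N}, with Lebesgue measure
   PiM {..<N} (%_. lborel).  Since 0 powr b = 0 for every b, the weight vanishes on the
   coincidence hyperplanes; these are null sets, so the measure is unaffected. *)
definition gbe_weight :: "nat \<Rightarrow> real \<Rightarrow> (nat \<Rightarrow> real) \<Rightarrow> real" where
  "gbe_weight N \<beta> x =
     (\<Prod>l<N. exp (- (x l)\<^sup>2 / 2)) * (\<Prod>k<N. \<Prod>j<k. \<bar>x k - x j\<bar> powr \<beta>)"

definition gbe_norm :: "nat \<Rightarrow> real \<Rightarrow> real" where
  "gbe_norm N \<beta> = (\<integral>x. gbe_weight N \<beta> x \<partial>PiM {..<N} (\<lambda>_. lborel))"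

definition gbe :: "nat \<Rightarrow> real \<Rightarrow> (nat \<Rightarrow> real) measure" where
  "gbe N \<beta> = density (PiM {..<N} (\<lambda>_. lborel)) (\<lambda>x. ennreal (gbe_weight N \<beta> x / gbe_norm N \<beta>))"

definition power_sum :: "nat \<Rightarrow> nat \<Rightarrow> (nat \<Rightarrow> real) \<Rightarrow> real" where
  "power_sum N p x = (\<Sum>j<N. x j ^ p)"

definition covariance :: "'a measure \<Rightarrow> ('a \<Rightarrow> real) \<Rightarrow> ('a \<Rightarrow> real) \<Rightarrow> real" where
  "covariance M X Y =
     (\<integral>x. (X x - (\<integral>y. X y \<partial>M)) * (Y x - (\<integral>y. Y y \<partial>M)) \<partial>M)"

(* Leonov-Shiryaev formula. The generating-function definition is not usable here, since
   exp (t * power_sum N p x) is in general not integrable. *)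
definition joint_cumulant :: "'a measure \<Rightarrow> 'i set \<Rightarrow> ('i \<Rightarrow> 'a \<Rightarrow> real) \<Rightarrow> real" where
  "joint_cumulant M I X =
     (\<Sum>P | partition_on I P.
        (- 1) ^ (card P - 1) * fact (card P - 1) * (\<Prod>B\<in>P. \<integral>x. (\<Prod>i\<in>B. X i x) \<partial>M))"

abbreviation gbe_ht :: "real \<Rightarrow> nat \<Rightarrow> (nat \<Rightarrow> real) measure" where
  "gbe_ht \<alpha> N \<equiv> gbe N (2 * \<alpha> / real N)"

(* An asymptotic (not necessarily convergent) series: the partial sum with L terms is
   correct up to O(N * N^{-L}), for every L. *)
definition large_N_ansatz :: "real \<Rightarrow> bool" where
  "large_N_ansatz \<alpha> \<longleftrightarrow>
     (\<forall>n\<ge>1. \<forall>p :: nat \<Rightarrow> nat. \<exists>c :: nat \<Rightarrow> real. \<forall>L.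
        (\<lambda>N. joint_cumulant (gbe_ht \<alpha> N) {..<n} (\<lambda>i. power_sum N (p i))
              - real N * (\<Sum>l<L. c l / real N ^ l))
          \<in> O(\<lambda>N. real N * (1 / real N ^ L)))"

definition scaled_moment :: "real \<Rightarrow> nat \<Rightarrow> nat \<Rightarrow> real" where
  "scaled_moment \<alpha> p N = (\<integral>x. power_sum N p x \<partial>gbe_ht \<alpha> N) / real N"

definition mG0 :: "real \<Rightarrow> nat \<Rightarrow> real" where
  "mG0 \<alpha> p = (THE a. \<exists>b. (\<lambda>N. scaled_moment \<alpha> p N - (a + b / real N)) \<in> O(\<lambda>N. 1 / real N ^ 2))"

definition mG1 :: "real \<Rightarrow> nat \<Rightarrow> real" where
  "mG1 \<alpha> p = (THE b. (\<lambda>N. scaled_moment \<alpha> p N - (mG0 \<alpha> p + b / real N)) \<in> O(\<lambda>N. 1 / real N ^ 2))"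

definition muG0 :: "real \<Rightarrow> nat \<Rightarrow> nat \<Rightarrow> real" where
  "muG0 \<alpha> p q =
     lim (\<lambda>N. covariance (gbe_ht \<alpha> N) (power_sum N p) (power_sum N q) / real N)"

definition mu_tildeG0 :: "real \<Rightarrow> nat \<Rightarrow> real" where
  "mu_tildeG0 \<alpha> n = (\<Sum>i\<le>n. muG0 \<alpha> i (n - i))"

end

theory Submission
  imports Defs "HOL-Real_Asymp.Real_Asymp"
begin

text \<open>
  Write \<open>S p\<close> for \<open>power_sum N p\<close>. Integrating \<open>\<Sum>i. \<partial>/\<partial>x i (x i ^ p * S q * weight)\<close> gives
  the loop equation, which expresses \<open>E (S q * S (p + 1))\<close> through expectations of products of at
  most three power sums. For \<open>q = 0\<close> it is an equation for the means; subtracting the multiple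
  \<open>E (S q)\<close> of that one leaves an equation for the covariances, in which the third cumulants enter
  with a factor \<open>\<alpha> / N\<close> and hence disappear in the limit. Comparing coefficients of \<open>1\<close> and
  \<open>1 / N\<close> yields the recurrences; the odd leading moments vanish by induction, so only even indices
  survive, and summing the covariance equation over \<open>p + q\<close> fixed uses the symmetry of the covariance.

  When \<open>\<alpha> < 0\<close> the weight is singular and its derivative is not integrable. The weight is therefore
  regularised by replacing \<open>\<bar>t\<bar> powr \<beta>\<close> with \<open>(t\<^sup>2 + \<epsilon>\<^sup>2) powr (\<beta> / 2)\<close>. After summing over \<open>i\<close> and
  symmetrising, the singular factors \<open>1 / (x i - x k)\<close> are absorbed into divided differences of
  \<open>t ^ p\<close>, so that \<open>\<epsilon> \<rightarrow> 0\<close> is a case of dominated convergence.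
\<close>

section \<open>One-dimensional estimates\<close>

text \<open>Two bounds on the regularised weight do different work. For fixed \<epsilon> > 0, a
  polynomial times a Gaussian bounds it at every point; this holds along every line, so boundary
  terms vanish, but the constant may blow up as \<epsilon> tends to 0. The limit needs a bound that
  is uniform in \<epsilon> and still integrable when many points come close together. A product over
  all pairs cannot be integrated one variable at a time; the envelope is a sum whose terms couple
  all points to a single centre, at the price of raising the exponent from 2\<alpha>/N to \<alpha>.
  Thus \<alpha> > -1, local integrability of |t|^\<alpha> on the line, suffices for every N at once.

  The interaction has no diagonal part i = k, whereas products of power sums do. Completing the
  double sum costs p times S (p - 1), one order in N below the products; this is the origin of the
  term -\<alpha>(2p+1) m_{2p,0} in the first correction.

  The ansatz is used only for n = 1, 2, 3: for the expansion of the means, the limit of the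
  covariances, and a bound O(N) on third cumulants.\<close>

lemma gauss_poly_le:
  fixes t :: real
  shows "(1 + \<bar>t\<bar>) ^ m * exp (- t\<^sup>2 / 2) \<le> exp ((real m)\<^sup>2) * exp (- t\<^sup>2 / 4)"
proof -
  have "(1 + \<bar>t\<bar>) ^ m \<le> exp \<bar>t\<bar> ^ m"
    by (intro power_mono exp_ge_add_one_self) auto
  also have "\<dots> = exp (real m * \<bar>t\<bar>)"
    by (simp add: exp_of_nat_mult)
  finally have "(1 + \<bar>t\<bar>) ^ m * exp (- t\<^sup>2 / 2) \<le> exp (real m * \<bar>t\<bar>) * exp (- t\<^sup>2 / 2)"
    by (intro mult_right_mono) auto
  also have "\<dots> = exp (real m * \<bar>t\<bar> - t\<^sup>2 / 2)"
    by (simp add: mult_exp_exp)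
  \<comment> \<open>Half of the Gaussian is spent on absorbing the polynomial; completing the square
    yields the constant \<open>exp (m^2)\<close>.\<close>
  also have "\<dots> \<le> exp ((real m)\<^sup>2 + - t\<^sup>2 / 4)"
  proof -
    have "0 \<le> (real m - \<bar>t\<bar> / 2)\<^sup>2" by simp
    also have "\<dots> = (real m)\<^sup>2 - real m * \<bar>t\<bar> + t\<^sup>2 / 4"
      by (simp add: power2_eq_square field_simps flip: abs_mult)
    finally show ?thesis by simp
  qed
  also have "\<dots> = exp ((real m)\<^sup>2) * exp (- t\<^sup>2 / 4)"
    by (rule exp_add)
  finally show ?thesis .
qed

lemma integrable_gauss: "integrable lborel (\<lambda>t::real. exp (- t\<^sup>2 / 4))"
proof -
  have "integrable lborel (\<lambda>t::real. sqrt (2 * pi * (sqrt 2)\<^sup>2) * normal_density 0 (sqrt 2) t)"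
    by (intro integrable_mult_right) auto
  also have "(\<lambda>t::real. sqrt (2 * pi * (sqrt 2)\<^sup>2) * normal_density 0 (sqrt 2) t) = (\<lambda>t. exp (- t\<^sup>2 / 4))"
    by (simp add: normal_density_def fun_eq_iff)
  finally show ?thesis .
qed

lemma nn_integral_gauss_poly:
  "(\<integral>\<^sup>+t. ennreal ((1 + \<bar>t\<bar>) ^ m * exp (- t\<^sup>2 / 2)) \<partial>lborel) < \<infinity>"
proof -
  have "integrable lborel (\<lambda>t::real. exp ((real m)\<^sup>2) * exp (- t\<^sup>2 / 4))"
    by (intro integrable_mult_right integrable_gauss)
  then have "integrable lborel (\<lambda>t::real. (1 + \<bar>t\<bar>) ^ m * exp (- t\<^sup>2 / 2))"
    by (rule Bochner_Integration.integrable_bound) (use gauss_poly_le in auto)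
  then show ?thesis
    by (simp add: integrable_iff_bounded)
qed

text \<open>This is where \<alpha> > -1 enters the analysis: the integral over {0..1} is 1/(\<alpha>
  + 1), and reflection covers the negative half.\<close>

lemma nn_integral_powr_near_0:
  assumes "\<alpha> > -1"
  shows "(\<integral>\<^sup>+t. ennreal (\<bar>t\<bar> powr \<alpha> * indicator {-1..1} t) \<partial>lborel) < \<infinity>"
proof -
  define h :: "real \<Rightarrow> real" where "h t = t powr \<alpha> * indicator {0..1} t" for t
  have h_meas [measurable]: "h \<in> borel_measurable borel" unfolding h_def by measurable
  have "((\<lambda>t. t powr \<alpha>) has_integral 1 / (\<alpha> + 1)) {0..1::real}"
    using has_integral_powr_from_0[OF assms, of 1] by simp
  then have "((\<lambda>t. if t \<in> {0..1} then t powr \<alpha> else 0) has_integral 1 / (\<alpha> + 1)) UNIV"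
    by (subst has_integral_restrict_UNIV)
  also have "(\<lambda>t. if t \<in> {0..1} then t powr \<alpha> else 0) = h"
    by (auto simp: h_def fun_eq_iff)
  finally have h: "(\<integral>\<^sup>+t. ennreal (h t) \<partial>lborel) = ennreal (1 / (\<alpha> + 1))"
    by (intro nn_integral_has_integral_lborel) (auto simp: h_def)
  have h': "(\<integral>\<^sup>+t. ennreal (h (- t)) \<partial>lborel) = ennreal (1 / (\<alpha> + 1))"
    using nn_integral_real_affine[of "\<lambda>t. ennreal (h t)" "-1" 0] h by simp
  have "(\<integral>\<^sup>+t. ennreal (\<bar>t\<bar> powr \<alpha> * indicator {-1..1} t) \<partial>lborel)
      \<le> (\<integral>\<^sup>+t. ennreal (h t) + ennreal (h (- t)) \<partial>lborel)"
    by (intro nn_integral_mono)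
       (auto simp: h_def indicator_def abs_if simp flip: ennreal_plus)
  also have "\<dots> = (\<integral>\<^sup>+t. ennreal (h t) \<partial>lborel) + (\<integral>\<^sup>+t. ennreal (h (- t)) \<partial>lborel)"
    by (intro nn_integral_add) auto
  also have "\<dots> < \<infinity>" unfolding h h' by simp
  finally show ?thesis .
qed

text \<open>A bound, uniform in \<open>0 \<le> \<epsilon> \<le> 1\<close>, for \<open>(t\<^sup>2 + \<epsilon>\<^sup>2) powr (\<alpha> / 2)\<close>, \<open>t \<noteq> 0\<close>.\<close>

definition pair_bound :: "real \<Rightarrow> real \<Rightarrow> real" where
  "pair_bound \<alpha> t = \<bar>t\<bar> powr \<alpha> + (t\<^sup>2 + 1) powr (\<alpha> / 2)"

lemma pair_bound_nonneg: "0 \<le> pair_bound \<alpha> t"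
  by (simp add: pair_bound_def)

lemma pair_bound_measurable [measurable]: "pair_bound \<alpha> \<in> borel_measurable borel"
  unfolding pair_bound_def by measurable

text \<open>The left side is monotone in \<epsilon>, in a direction depending on the sign of
  \<alpha>, so one of its values at \<epsilon> = 0 and \<epsilon> = 1 is an upper bound;
  \<open>pair_bound\<close> adds the two. For negative \<alpha>, t \<noteq> 0 excludes the
  convention \<open>0 powr a = 0\<close>, under which the value at \<epsilon> = 0 would be no
  bound.\<close>

lemma powr_le_pair_bound:
  assumes "t \<noteq> 0" "0 \<le> \<epsilon>" "\<epsilon> \<le> 1"
  shows "(t\<^sup>2 + \<epsilon>\<^sup>2) powr (\<alpha> / 2) \<le> pair_bound \<alpha> t"
proof (cases "\<alpha> \<ge> 0")
  case True
  have "\<epsilon>\<^sup>2 \<le> 1" using assms by (simp add: power_le_one)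
  then have "(t\<^sup>2 + \<epsilon>\<^sup>2) powr (\<alpha> / 2) \<le> (t\<^sup>2 + 1) powr (\<alpha> / 2)"
    using True by (intro powr_mono2) auto
  then show ?thesis by (simp add: pair_bound_def add_increasing)
next
  case False
  have "(t\<^sup>2 + \<epsilon>\<^sup>2) powr (\<alpha> / 2) \<le> (t\<^sup>2) powr (\<alpha> / 2)"
    using False assms by (intro powr_mono2') auto
  also have "\<dots> = \<bar>t\<bar> powr \<alpha>"
    using assms powr_powr[of "\<bar>t\<bar>" 2 "\<alpha> / 2"] by (simp add: powr_numeral)
  finally show ?thesis by (simp add: pair_bound_def add_increasing2)
qed

lemma one_plus_diff_sq_le:
  fixes a b :: real
  shows "(a - b)\<^sup>2 + 1 \<le> ((1 + \<bar>a\<bar>) * (1 + \<bar>b\<bar>))\<^sup>2"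
proof -
  have "\<bar>a - b\<bar> \<le> \<bar>a\<bar> + \<bar>b\<bar>" by simp
  then have "(a - b)\<^sup>2 \<le> (\<bar>a\<bar> + \<bar>b\<bar>)\<^sup>2" by (rule power2_le_iff_abs_le[THEN iffD2, rotated]) simp
  moreover have "1 + (\<bar>a\<bar> + \<bar>b\<bar>)\<^sup>2 \<le> (1 + (\<bar>a\<bar> + \<bar>b\<bar>))\<^sup>2"
    by (simp add: power2_sum)
  moreover have "(1 + (\<bar>a\<bar> + \<bar>b\<bar>))\<^sup>2 \<le> ((1 + \<bar>a\<bar>) * (1 + \<bar>b\<bar>))\<^sup>2"
    by (intro power_mono) (auto simp: algebra_simps)
  ultimately show ?thesis by linarith
qed

text \<open>Separates the singularity, confined to |a - b| \<le> 1, from the growth at infinity. The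
  growth is factored over a and b because one of them is integrated out while the other stays
  fixed.\<close>

lemma pair_bound_le:
  obtains n where "\<And>a b. pair_bound \<alpha> (a - b)
    \<le> \<bar>a - b\<bar> powr \<alpha> * indicator {-1..1} (a - b) + 2 * ((1 + \<bar>a\<bar>) * (1 + \<bar>b\<bar>)) ^ n"
proof -
  define n where "n = nat \<lceil>\<bar>\<alpha>\<bar>\<rceil>"
  have n: "\<bar>\<alpha>\<bar> \<le> real n" unfolding n_def by linarith
  have le: "(t\<^sup>2 + 1) powr c \<le> (t\<^sup>2 + 1) ^ n" if "c \<le> \<bar>\<alpha>\<bar>" for t c :: real
  proof -
    have "(t\<^sup>2 + 1) powr c \<le> (t\<^sup>2 + 1) powr (real n)"
      using that n by (intro powr_mono) auto
    also have "\<dots> = (t\<^sup>2 + 1) ^ n"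
      by (rule powr_realpow) (auto intro: add_nonneg_pos)
    finally show ?thesis .
  qed
  have abs_le: "\<bar>t\<bar> powr \<alpha> \<le> (t\<^sup>2 + 1) ^ n" if "\<bar>t\<bar> > 1" for t
  proof -
    have "\<bar>t\<bar> * 1 \<le> \<bar>t\<bar> * \<bar>t\<bar>" using that by (intro mult_left_mono) auto
    then have "\<bar>t\<bar> \<le> t\<^sup>2 + 1" by (simp add: power2_eq_square)
    have "\<bar>t\<bar> powr \<alpha> \<le> \<bar>t\<bar> powr \<bar>\<alpha>\<bar>" using that by (intro powr_mono) auto
    also have "\<dots> \<le> (t\<^sup>2 + 1) powr \<bar>\<alpha>\<bar>" using \<open>\<bar>t\<bar> \<le> t\<^sup>2 + 1\<close> by (intro powr_mono2) auto
    also have "\<dots> \<le> (t\<^sup>2 + 1) ^ n" by (rule le) simp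
    finally show ?thesis .
  qed
  have "pair_bound \<alpha> (a - b)
    \<le> \<bar>a - b\<bar> powr \<alpha> * indicator {-1..1} (a - b) + 2 * ((1 + \<bar>a\<bar>) * (1 + \<bar>b\<bar>)) ^ (2 * n)" for a b
  proof -
    have "((a - b)\<^sup>2 + 1) ^ n \<le> (((1 + \<bar>a\<bar>) * (1 + \<bar>b\<bar>))\<^sup>2) ^ n"
      by (intro power_mono one_plus_diff_sq_le) auto
    then have 1: "((a - b)\<^sup>2 + 1) ^ n \<le> ((1 + \<bar>a\<bar>) * (1 + \<bar>b\<bar>)) ^ (2 * n)"
      by (simp only: power_mult)
    have 2: "((a - b)\<^sup>2 + 1) powr (\<alpha> / 2) \<le> ((a - b)\<^sup>2 + 1) ^ n"
      by (rule le) linarith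
    have 3: "\<bar>a - b\<bar> powr \<alpha> \<le> \<bar>a - b\<bar> powr \<alpha> * indicator {-1..1} (a - b) + ((a - b)\<^sup>2 + 1) ^ n"
      using abs_le[of "a - b"] by (cases "\<bar>a - b\<bar> \<le> 1") (auto simp: indicator_def)
    show ?thesis unfolding pair_bound_def using 1 2 3 by linarith
  qed
  then show thesis by (rule that)
qed

text \<open>Integrating out one point that interacts with a centre y leaves only polynomial
  dependence on y, which the Gaussian factor of y can absorb later.\<close>

lemma nn_integral_pair_bound:
  assumes "\<alpha> > -1"
  obtains C k where "0 \<le> C" "\<And>y. (\<integral>\<^sup>+t. ennreal (pair_bound \<alpha> (y - t) * ((1 + \<bar>t\<bar>) ^ m * exp (- t\<^sup>2 / 2))) \<partial>lborel)
     \<le> ennreal (C * (1 + \<bar>y\<bar>) ^ k)"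
proof -
  obtain n where n: "\<And>a b. pair_bound \<alpha> (a - b)
    \<le> \<bar>a - b\<bar> powr \<alpha> * indicator {-1..1} (a - b) + 2 * ((1 + \<bar>a\<bar>) * (1 + \<bar>b\<bar>)) ^ n"
    using pair_bound_le by blast
  define g where "g m t = (1 + \<bar>t\<bar>) ^ m * exp (- t\<^sup>2 / 2)" for m and t :: real
  have g_meas [measurable]: "g m \<in> borel_measurable borel" for m unfolding g_def by measurable
  have g0: "0 \<le> g m t" for m t by (simp add: g_def)
  \<comment> \<open>Near the singularity it is enough to bound the Gaussian factor by a constant;
    away from it, its decay is kept to compensate the polynomial growth.\<close>
  define K where "K = exp ((real m)\<^sup>2)"
  have gK: "g m t \<le> K" for t
  proof -
    have "K * exp (- t\<^sup>2 / 4) \<le> K * 1" unfolding K_def by (intro mult_left_mono) auto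
    with gauss_poly_le[of t m] show ?thesis unfolding g_def K_def by linarith
  qed
  have K0: "0 \<le> K" by (simp add: K_def)
  define s where "s t = \<bar>t\<bar> powr \<alpha> * indicator {-1..1} t" for t :: real
  have s_meas [measurable]: "s \<in> borel_measurable borel" unfolding s_def by measurable
  have s0: "0 \<le> s t" for t by (simp add: s_def)
  obtain A where A: "(\<integral>\<^sup>+t. ennreal (s t) \<partial>lborel) = ennreal A" "0 \<le> A"
    using nn_integral_powr_near_0[OF assms] unfolding s_def by (auto simp: less_top_ennreal)
  obtain B where B: "(\<integral>\<^sup>+t. ennreal (g (n + m) t) \<partial>lborel) = ennreal B" "0 \<le> B"
    using nn_integral_gauss_poly[of "n + m"] unfolding g_def by (auto simp: less_top_ennreal)
  have bd: "(\<integral>\<^sup>+t. ennreal (pair_bound \<alpha> (y - t) * g m t) \<partial>lborel)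
      \<le> ennreal ((K * A + 2 * B) * (1 + \<bar>y\<bar>) ^ n)" for y
  proof -
    have "(\<integral>\<^sup>+t. ennreal (pair_bound \<alpha> (y - t) * g m t) \<partial>lborel)
      \<le> (\<integral>\<^sup>+t. ennreal K * ennreal (s (y - t)) + ennreal (2 * (1 + \<bar>y\<bar>) ^ n) * ennreal (g (n + m) t) \<partial>lborel)"
    proof (intro nn_integral_mono)
      fix t
      have "pair_bound \<alpha> (y - t) * g m t \<le> (s (y - t) + 2 * ((1 + \<bar>y\<bar>) * (1 + \<bar>t\<bar>)) ^ n) * g m t"
        unfolding s_def by (intro mult_right_mono n g0)
      also have "\<dots> = s (y - t) * g m t + 2 * (1 + \<bar>y\<bar>) ^ n * g (n + m) t"
        unfolding g_def power_add power_mult_distrib by (simp add: algebra_simps)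
      also have "s (y - t) * g m t \<le> s (y - t) * K"
        by (intro mult_left_mono gK s0)
      finally show "ennreal (pair_bound \<alpha> (y - t) * g m t) \<le> ennreal K * ennreal (s (y - t)) + ennreal (2 * (1 + \<bar>y\<bar>) ^ n) * ennreal (g (n + m) t)"
        using K0 s0 g0 by (simp add: mult.commute flip: ennreal_mult ennreal_plus)
    qed
    also have "\<dots> = ennreal K * (\<integral>\<^sup>+t. ennreal (s (y - t)) \<partial>lborel) + ennreal (2 * (1 + \<bar>y\<bar>) ^ n) * ennreal B"
      by (simp add: nn_integral_add nn_integral_cmult B)
    also have "(\<integral>\<^sup>+t. ennreal (s (y - t)) \<partial>lborel) = ennreal A"
      using nn_integral_real_affine[of "\<lambda>t. ennreal (s t)" "-1" y] A by simp
    also have "ennreal K * ennreal A + ennreal (2 * (1 + \<bar>y\<bar>) ^ n) * ennreal B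
        = ennreal (K * A + 2 * (1 + \<bar>y\<bar>) ^ n * B)"
      using K0 A B by (simp flip: ennreal_mult ennreal_plus)
    also have "\<dots> \<le> ennreal ((K * A + 2 * B) * (1 + \<bar>y\<bar>) ^ n)"
    proof (intro ennreal_leI)
      have "K * A * 1 \<le> K * A * (1 + \<bar>y\<bar>) ^ n" using K0 A by (intro mult_left_mono one_le_power) auto
      then show "K * A + 2 * (1 + \<bar>y\<bar>) ^ n * B \<le> (K * A + 2 * B) * (1 + \<bar>y\<bar>) ^ n"
        by (simp add: algebra_simps)
    qed
    finally show ?thesis .
  qed
  show thesis using bd K0 A B by (intro that[of "K * A + 2 * B" n]) (auto simp: g_def)
qed

lemma integral_derivative_eq_0:
  fixes F f :: "real \<Rightarrow> real"
  assumes "\<And>y. (F has_real_derivative f y) (at y)" "\<And>y. isCont f y" "integrable lborel f"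
    and bound: "\<And>y. \<bar>F y\<bar> \<le> C * exp (- y\<^sup>2 / 4)"
  shows "integral\<^sup>L lborel f = 0"
proof -
  have lim: "((\<lambda>y. C * exp (- y\<^sup>2 / 4)) \<longlongrightarrow> 0) at_top" "((\<lambda>y. C * exp (- y\<^sup>2 / 4)) \<longlongrightarrow> 0) at_bot"
    by real_asymp+
  have "(F \<longlongrightarrow> 0) at_top" "(F \<longlongrightarrow> 0) at_bot"
    using bound by (auto intro!: Lim_null_comparison[OF _ lim(1)] Lim_null_comparison[OF _ lim(2)] always_eventually)
  then have "((F \<circ> real_of_ereal) \<longlongrightarrow> 0) (at_right (-\<infinity>))" "((F \<circ> real_of_ereal) \<longlongrightarrow> 0) (at_left \<infinity>)"
    by (simp_all add: ereal_tendsto_simps)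
  then have "(LBINT x=-\<infinity>..\<infinity>. f x) = 0 - 0"
    using assms
    by (intro interval_integral_FTC_integrable)
       (auto simp: has_real_derivative_iff_has_vector_derivative set_integrable_def)
  then show ?thesis by (simp add: interval_lebesgue_integral_def set_lebesgue_integral_def)
qed

section \<open>Integrability of the weight\<close>

interpretation lborel_product: product_sigma_finite "\<lambda>_. lborel :: real measure"
  by standard

lemma component_measurable:
  fixes j N :: nat
  assumes "j < N"
  shows "(\<lambda>x. x j) \<in> borel_measurable (PiM {..<N} (\<lambda>_. lborel :: real measure))"
  using assms measurable_component_singleton[of j "{..<N}" "\<lambda>_. lborel :: real measure"] by simp

definition reg_weight :: "nat \<Rightarrow> real \<Rightarrow> real \<Rightarrow> (nat \<Rightarrow> real) \<Rightarrow> real" where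
  "reg_weight N \<beta> \<epsilon> x =
     (\<Prod>l<N. exp (- (x l)\<^sup>2 / 2)) * (\<Prod>k<N. \<Prod>j<k. ((x k - x j)\<^sup>2 + \<epsilon>\<^sup>2) powr (\<beta> / 2))"

lemma reg_weight_0: "reg_weight N \<beta> 0 = gbe_weight N \<beta>"
proof -
  have "(t\<^sup>2) powr (\<beta> / 2) = \<bar>t\<bar> powr \<beta>" for t :: real
    using powr_powr[of "\<bar>t\<bar>" 2 "\<beta> / 2"] by (cases "t = 0") (simp_all add: powr_numeral)
  then show ?thesis by (simp add: fun_eq_iff reg_weight_def gbe_weight_def)
qed

lemma reg_weight_nonneg: "0 \<le> reg_weight N \<beta> \<epsilon> x"
  unfolding reg_weight_def by (intro mult_nonneg_nonneg prod_nonneg) auto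

lemma reg_weight_measurable [measurable]:
  "reg_weight N \<beta> \<epsilon> \<in> borel_measurable (PiM {..<N} (\<lambda>_. lborel))"
proof -
  have "(\<lambda>x. exp (- (x l)\<^sup>2 / 2)) \<in> borel_measurable (PiM {..<N} (\<lambda>_. lborel :: real measure))" if "l < N" for l
    using component_measurable[OF that] by measurable
  moreover have "(\<lambda>x. ((x k - x j)\<^sup>2 + \<epsilon>\<^sup>2) powr (\<beta> / 2)) \<in> borel_measurable (PiM {..<N} (\<lambda>_. lborel :: real measure))"
    if "k < N" "j < N" for k j
    using component_measurable[OF that(1)] component_measurable[OF that(2)] by measurable
  ultimately show ?thesis
    unfolding reg_weight_def by (intro borel_measurable_times borel_measurable_prod) auto
qed

text \<open>A product rather than a norm: it dominates every coordinate, and its powers factor over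
  the coordinates, as do the Gaussian and the measure.\<close>

definition growth :: "nat \<Rightarrow> (nat \<Rightarrow> real) \<Rightarrow> real" where
  "growth N x = (\<Prod>l<N. 1 + \<bar>x l\<bar>)"

lemma growth_ge_1: "1 \<le> growth N x"
  unfolding growth_def by (intro prod_ge_1) auto

lemma abs_le_growth: "j < N \<Longrightarrow> 1 + \<bar>x j\<bar> \<le> growth N x"
  unfolding growth_def by (subst prod.remove[of _ j]) (auto intro!: mult_le_cancel_left1[THEN iffD2] prod_ge_1)

text \<open>A line in direction i meets the hyperplane \<open>x i = x j\<close> in one point, so
  Fubini makes it null. Arguments that would meet \<open>0 powr a\<close> are carried out off these
  hyperplanes.\<close>

lemma AE_coordinates_distinct:
  "AE x in PiM {..<N::nat} (\<lambda>_. lborel :: real measure). \<forall>i<N. \<forall>j<N. i \<noteq> j \<longrightarrow> x i \<noteq> x j"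
proof -
  have "AE x in PiM {..<N} (\<lambda>_. lborel :: real measure). x i \<noteq> x j" if ij: "i < N" "j < N" "i \<noteq> j" for i j
  proof -
    define J where "J = {..<N} - {i}"
    have J: "{..<N} = insert i J" "finite J" "i \<notin> J" "j \<in> J" using ij by (auto simp: J_def)
    define S where "S = {x \<in> space (PiM {..<N} (\<lambda>_. lborel :: real measure)). x i = x j}"
    have S: "S \<in> sets (PiM {..<N} (\<lambda>_. lborel :: real measure))"
      unfolding S_def using component_measurable[OF ij(1)] component_measurable[OF ij(2)] by measurable
    have "emeasure (PiM {..<N} (\<lambda>_. lborel)) S = (\<integral>\<^sup>+x. indicator S x \<partial>PiM {..<N} (\<lambda>_. lborel))"
      using S by simp
    also have "\<dots> = (\<integral>\<^sup>+x. (\<integral>\<^sup>+y. indicator S (x(i := y)) \<partial>lborel) \<partial>PiM J (\<lambda>_. lborel))"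
      unfolding J(1) using J(2,3) S[unfolded J(1)]
      by (intro lborel_product.product_nn_integral_insert) auto
    also have "\<dots> \<le> (\<integral>\<^sup>+x. (\<integral>\<^sup>+y. indicator {x j} y \<partial>lborel) \<partial>PiM J (\<lambda>_. lborel :: real measure))"
      using ij by (intro nn_integral_mono) (auto simp: indicator_def S_def)
    also have "\<dots> = 0" by simp
    finally show ?thesis using S by (intro AE_I'[of S]) (auto simp: S_def)
  qed
  then show ?thesis by (auto simp: AE_all_countable)
qed

text \<open>Every factor is at most the largest one, and the N-th power of the largest one is among
  the summands.\<close>

lemma prod_le_sum_power:
  fixes b :: "nat \<Rightarrow> real"
  assumes "N > 0" "\<And>i. i < N \<Longrightarrow> 0 \<le> b i"
  shows "(\<Prod>i<N. b i) \<le> (\<Sum>i<N. b i ^ N)"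
proof -
  have "Max (b ` {..<N}) \<in> b ` {..<N}" using assms by (intro Max_in) auto
  then obtain i where i: "i < N" "Max (b ` {..<N}) = b i" by auto
  have "b j \<le> b i" if "j < N" for j unfolding i(2)[symmetric] using that by (intro Max_ge) auto
  then have "(\<Prod>j<N. b j) \<le> (\<Prod>j<N. b i)" using assms by (intro prod_mono) auto
  also have "\<dots> = b i ^ N" by simp
  also have "\<dots> \<le> (\<Sum>i<N. b i ^ N)" using i assms by (intro member_le_sum) auto
  finally show ?thesis .
qed

lemma prod_off_diagonal:
  fixes f :: "nat \<Rightarrow> nat \<Rightarrow> 'a :: comm_monoid_mult"
  shows "(\<Prod>i<N. \<Prod>j\<in>{..<N} - {i}. f i j) = (\<Prod>k<N. \<Prod>j<k. f k j * f j k)"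
proof (induction N)
  case (Suc N)
  have eq: "(\<Prod>j\<in>{..<Suc N} - {i}. f i j) = (\<Prod>j\<in>{..<N} - {i}. f i j) * f i N" if "i < N" for i
  proof -
    have "{..<Suc N} - {i} = insert N ({..<N} - {i})" using that by auto
    then show ?thesis by (simp add: mult.commute)
  qed
  have "{..<Suc N} - {N} = {..<N}" by auto
  then show ?case by (simp add: eq prod.distrib Suc mult_ac)
qed simp

definition envelope :: "nat \<Rightarrow> real \<Rightarrow> (nat \<Rightarrow> real) \<Rightarrow> real" where
  "envelope N \<alpha> x =
     (\<Prod>l<N. exp (- (x l)\<^sup>2 / 2)) * (\<Sum>i<N. \<Prod>j\<in>{..<N} - {i}. pair_bound \<alpha> (x i - x j))"

lemma envelope_nonneg: "0 \<le> envelope N \<alpha> x"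
  unfolding envelope_def by (intro mult_nonneg_nonneg prod_nonneg sum_nonneg) (auto simp: pair_bound_nonneg)

text \<open>Splitting the interaction over ordered pairs as \<open>\<Prod>i. b i\<close>, the bound \<open>\<Prod>i. b i \<le> \<Sum>i. b i ^ N\<close>
  turns the exponent \<open>2 * \<alpha> / N\<close> into \<open>\<alpha>\<close> and leaves only the pairs containing \<open>i\<close>.\<close>

lemma reg_weight_le_envelope:
  assumes "N > 0" "0 \<le> \<epsilon>" "\<epsilon> \<le> 1" and distinct: "\<forall>i<N. \<forall>j<N. i \<noteq> j \<longrightarrow> x i \<noteq> x j"
  shows "reg_weight N (2 * \<alpha> / real N) \<epsilon> x \<le> envelope N \<alpha> x"
proof -
  define u where "u i j = (x i - x j)\<^sup>2 + \<epsilon>\<^sup>2" for i j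
  \<comment> \<open>An unordered pair carries the exponent \<beta>/2 = \<alpha>/N, shared equally by
    its two orderings.\<close>
  define c where "c = \<alpha> / real N / 2"
  define b where "b i = (\<Prod>j\<in>{..<N} - {i}. u i j powr c)" for i
  have u0: "0 \<le> u i j" for i j by (simp add: u_def)
  have "(\<Prod>k<N. \<Prod>j<k. u k j powr (2 * \<alpha> / real N / 2)) = (\<Prod>k<N. \<Prod>j<k. u k j powr c * u j k powr c)"
    by (intro prod.cong refl) (simp add: u_def c_def power2_commute flip: powr_add)
  also have "\<dots> = (\<Prod>i<N. b i)"
    unfolding b_def by (rule prod_off_diagonal[symmetric])
  also have "\<dots> \<le> (\<Sum>i<N. b i ^ N)"
    using \<open>N > 0\<close> by (intro prod_le_sum_power) (auto simp: b_def intro!: prod_nonneg)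
  also have "\<dots> = (\<Sum>i<N. \<Prod>j\<in>{..<N} - {i}. u i j powr (\<alpha> / 2))"
  proof -
    have "(u i j powr c) ^ N = u i j powr (\<alpha> / 2)" for i j
      using \<open>N > 0\<close> powr_power[of "u i j" c N] by (cases "u i j = 0") (simp_all add: c_def)
    then show ?thesis by (simp add: b_def prod_power_distrib)
  qed
  also have "\<dots> \<le> (\<Sum>i<N. \<Prod>j\<in>{..<N} - {i}. pair_bound \<alpha> (x i - x j))"
    using assms unfolding u_def by (intro sum_mono prod_mono) (auto intro!: powr_le_pair_bound)
  finally show ?thesis
    unfolding reg_weight_def envelope_def u_def by (intro mult_left_mono) (auto intro!: prod_nonneg)
qed

text \<open>In the i-th summand the other points interact with x i only. Once x i is fixed, the
  integral over them is a product of one-dimensional integrals, each polynomially bounded in |x i|,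
  and the Gaussian in x i integrates the resulting power.\<close>

lemma integrable_growth_envelope:
  assumes "\<alpha> > -1"
  shows "integrable (PiM {..<N} (\<lambda>_. lborel)) (\<lambda>x. growth N x ^ m * envelope N \<alpha> x)"
proof -
  define g where "g t = (1 + \<bar>t\<bar>) ^ m * exp (- t\<^sup>2 / 2)" for t :: real
  have g_meas [measurable]: "g \<in> borel_measurable borel" unfolding g_def by measurable
  have g0: "0 \<le> g t" for t by (simp add: g_def)
  obtain C k where C: "0 \<le> C" "\<And>y. (\<integral>\<^sup>+t. ennreal (pair_bound \<alpha> (y - t) * g t) \<partial>lborel)
     \<le> ennreal (C * (1 + \<bar>y\<bar>) ^ k)"
    using nn_integral_pair_bound[OF assms, of m] unfolding g_def by blast
  define h where "h i x = g (x i) * (\<Prod>j\<in>{..<N} - {i}. pair_bound \<alpha> (x i - x j) * g (x j))" for i and x :: "nat \<Rightarrow> real"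
  have h0: "0 \<le> h i x" for i x
    unfolding h_def by (intro mult_nonneg_nonneg prod_nonneg) (auto simp: g0 pair_bound_nonneg)
  have "integrable (PiM {..<N} (\<lambda>_. lborel)) (h i)" if i: "i < N" for i
  proof -
    define J where "J = {..<N} - {i}"
    have J: "{..<N} = insert i J" "finite J" "i \<notin> J" using i by (auto simp: J_def)
    have [measurable]: "h i \<in> borel_measurable (PiM (insert i J) (\<lambda>_. lborel))"
      unfolding h_def J(1)[symmetric] J_def[symmetric]
      using i by (intro borel_measurable_times borel_measurable_prod measurable_compose[OF _ g_meas]
          measurable_compose[OF _ pair_bound_measurable] borel_measurable_diff) (auto simp: J_def)
    \<comment> \<open>The centre is integrated last, so that the inner integrand is a product over
      \<open>J\<close>.\<close>
    have "(\<integral>\<^sup>+x. ennreal (h i x) \<partial>PiM {..<N} (\<lambda>_. lborel))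
        = (\<integral>\<^sup>+y. (\<integral>\<^sup>+x. ennreal (h i (x(i := y))) \<partial>PiM J (\<lambda>_. lborel)) \<partial>lborel)"
      unfolding J(1) using J by (intro lborel_product.product_nn_integral_insert_rev) auto
    also have "\<dots> = (\<integral>\<^sup>+y. (\<integral>\<^sup>+x. ennreal (g y) * (\<Prod>j\<in>J. ennreal (pair_bound \<alpha> (y - x j) * g (x j))) \<partial>PiM J (\<lambda>_. lborel)) \<partial>lborel)"
    proof (intro nn_integral_cong)
      fix y x
      have "h i (x(i := y)) = g y * (\<Prod>j\<in>J. pair_bound \<alpha> (y - x j) * g (x j))"
        using J(3) unfolding h_def J_def[symmetric] by (auto intro!: prod.cong arg_cong2[of _ _ _ _ "(*)"])
      then show "ennreal (h i (x(i := y))) = ennreal (g y) * (\<Prod>j\<in>J. ennreal (pair_bound \<alpha> (y - x j) * g (x j)))"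
        by (subst prod_ennreal) (auto simp: g0 pair_bound_nonneg simp flip: ennreal_mult')
    qed
    also have "\<dots> = (\<integral>\<^sup>+y. ennreal (g y) * (\<Prod>j\<in>J. (\<integral>\<^sup>+t. ennreal (pair_bound \<alpha> (y - t) * g t) \<partial>lborel)) \<partial>lborel)"
    proof (intro nn_integral_cong)
      fix y
      have "(\<integral>\<^sup>+x. (\<Prod>j\<in>J. ennreal (pair_bound \<alpha> (y - x j) * g (x j))) \<partial>PiM J (\<lambda>_. lborel))
        = (\<Prod>j\<in>J. (\<integral>\<^sup>+t. ennreal (pair_bound \<alpha> (y - t) * g t) \<partial>lborel))"
        using J by (intro lborel_product.product_nn_integral_prod) auto
      moreover have "(\<lambda>x. \<Prod>j\<in>J. ennreal (pair_bound \<alpha> (y - x j) * g (x j))) \<in> borel_measurable (PiM J (\<lambda>_. lborel))"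
        by measurable
      ultimately show "(\<integral>\<^sup>+x. ennreal (g y) * (\<Prod>j\<in>J. ennreal (pair_bound \<alpha> (y - x j) * g (x j))) \<partial>PiM J (\<lambda>_. lborel))
        = ennreal (g y) * (\<Prod>j\<in>J. (\<integral>\<^sup>+t. ennreal (pair_bound \<alpha> (y - t) * g t) \<partial>lborel))"
        by (simp add: nn_integral_cmult)
    qed
    also have "\<dots> \<le> (\<integral>\<^sup>+y. ennreal (g y) * (\<Prod>j\<in>J. ennreal (C * (1 + \<bar>y\<bar>) ^ k)) \<partial>lborel)"
      using C(2) by (intro nn_integral_mono mult_left_mono) (auto intro!: power_mono)
    also have "\<dots> = (\<integral>\<^sup>+y. ennreal (C ^ card J) * ennreal ((1 + \<bar>y\<bar>) ^ (m + k * card J) * exp (- y\<^sup>2 / 2)) \<partial>lborel)"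
      by (intro nn_integral_cong)
         (simp add: ennreal_power C(1) g_def power_mult_distrib power_add power_mult mult_ac flip: ennreal_mult)
    also have "\<dots> = ennreal (C ^ card J) * (\<integral>\<^sup>+y. ennreal ((1 + \<bar>y\<bar>) ^ (m + k * card J) * exp (- y\<^sup>2 / 2)) \<partial>lborel)"
      by (intro nn_integral_cmult) measurable
    also have "\<dots> < \<infinity>"
      using nn_integral_gauss_poly[of "m + k * card J"] by (simp add: ennreal_mult_less_top)
    finally show ?thesis
      by (auto simp: integrable_iff_bounded h0 J(1))
  qed
  then have "integrable (PiM {..<N} (\<lambda>_. lborel)) (\<lambda>x. \<Sum>i<N. h i x)"
    by (intro Bochner_Integration.integrable_sum) auto
  also have "(\<lambda>x. \<Sum>i<N. h i x) = (\<lambda>x. growth N x ^ m * envelope N \<alpha> x)"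
  proof
    fix x :: "nat \<Rightarrow> real"
    have "h i x = (\<Prod>l<N. g (x l)) * (\<Prod>j\<in>{..<N} - {i}. pair_bound \<alpha> (x i - x j))" if "i < N" for i
      using that by (simp add: h_def prod.distrib prod.remove[of "{..<N}" i])
    then have "(\<Sum>i<N. h i x) = (\<Prod>l<N. g (x l)) * (\<Sum>i<N. \<Prod>j\<in>{..<N} - {i}. pair_bound \<alpha> (x i - x j))"
      by (simp add: sum_distrib_left)
    then show "(\<Sum>i<N. h i x) = growth N x ^ m * envelope N \<alpha> x"
      by (simp add: g_def growth_def envelope_def prod.distrib prod_power_distrib)
  qed
  finally show ?thesis .
qed

lemma prod_doubleton_le_growth:
  assumes "k < N" "j < N" "k \<noteq> j"
  shows "(1 + \<bar>x k\<bar>) * (1 + \<bar>x j\<bar>) \<le> growth N x"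
proof -
  have "growth N x = (\<Prod>l\<in>{k, j}. 1 + \<bar>x l\<bar>) * (\<Prod>l\<in>{..<N} - {k, j}. 1 + \<bar>x l\<bar>)"
    unfolding growth_def using assms by (subst prod.subset_diff[of "{k, j}"]) (auto simp: mult.commute)
  also have "\<dots> \<ge> (\<Prod>l\<in>{k, j}. 1 + \<bar>x l\<bar>) * 1"
    by (intro mult_left_mono prod_ge_1 prod_nonneg) auto
  finally show ?thesis using assms by simp
qed

text \<open>Holds at every point, coincidences included, with a constant depending on \<epsilon>.
  Integration by parts needs such a bound on each individual line, where an almost everywhere
  statement would say nothing. For \<beta> < 0 a pair factor is at most its value at coincidence,
  whence the second summand of \<open>A\<close>.\<close>

lemma reg_weight_le_growth:
  assumes "0 < \<epsilon>" "\<epsilon> \<le> 1"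
  obtains C k where "0 \<le> C" "\<And>x. reg_weight N \<beta> \<epsilon> x \<le> C * growth N x ^ k * (\<Prod>l<N. exp (- (x l)\<^sup>2 / 2))"
proof -
  define n where "n = nat \<lceil>\<bar>\<beta> / 2\<bar>\<rceil>"
  define A where "A = 1 + (\<epsilon>\<^sup>2) powr (\<beta> / 2)"
  have A1: "1 \<le> A" by (simp add: A_def)
  have n: "\<bar>\<beta> / 2\<bar> \<le> real n" unfolding n_def by linarith
  have pair: "((x k - x j)\<^sup>2 + \<epsilon>\<^sup>2) powr (\<beta> / 2) \<le> A * growth N x ^ (2 * n)" if "k < N" "j < k" for x k j
  proof (cases "\<beta> \<ge> 0")
    case True
    have "\<epsilon>\<^sup>2 \<le> 1" using assms by (simp add: power_le_one)
    then have "((x k - x j)\<^sup>2 + \<epsilon>\<^sup>2) \<le> (x k - x j)\<^sup>2 + 1" by simp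
    also have "\<dots> \<le> ((1 + \<bar>x k\<bar>) * (1 + \<bar>x j\<bar>))\<^sup>2" by (rule one_plus_diff_sq_le)
    also have "\<dots> \<le> growth N x ^ 2"
      using that by (intro power_mono prod_doubleton_le_growth) auto
    finally have le: "(x k - x j)\<^sup>2 + \<epsilon>\<^sup>2 \<le> growth N x ^ 2" .
    have "((x k - x j)\<^sup>2 + \<epsilon>\<^sup>2) powr (\<beta> / 2) \<le> (growth N x ^ 2) powr (\<beta> / 2)"
      using True le by (intro powr_mono2) auto
    also have "\<dots> \<le> (growth N x ^ 2) powr (real n)"
      using n growth_ge_1[of N x] by (intro powr_mono one_le_power) auto
    also have "\<dots> = 1 * growth N x ^ (2 * n)"
      using growth_ge_1[of N x] by (subst powr_realpow) (auto simp: power_mult intro!: zero_less_power)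
    also have "\<dots> \<le> A * growth N x ^ (2 * n)"
      using growth_ge_1[of N x] A1 by (intro mult_right_mono) auto
    finally show ?thesis .
  next
    case False
    have "((x k - x j)\<^sup>2 + \<epsilon>\<^sup>2) powr (\<beta> / 2) \<le> (\<epsilon>\<^sup>2) powr (\<beta> / 2)"
      using False assms by (intro powr_mono2') auto
    also have "\<dots> \<le> A * 1" by (simp add: A_def)
    also have "\<dots> \<le> A * growth N x ^ (2 * n)"
      using A1 growth_ge_1[of N x] by (intro mult_left_mono one_le_power) auto
    finally show ?thesis .
  qed
  define M where "M = (\<Sum>k<N. \<Sum>j<k. 1 :: nat)"
  have "reg_weight N \<beta> \<epsilon> x \<le> A ^ M * growth N x ^ (2 * n * M) * (\<Prod>l<N. exp (- (x l)\<^sup>2 / 2))" for x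
  proof -
    have "(\<Prod>k<N. \<Prod>j<k. ((x k - x j)\<^sup>2 + \<epsilon>\<^sup>2) powr (\<beta> / 2)) \<le> (\<Prod>k<N. \<Prod>j<k. A * growth N x ^ (2 * n))"
      by (intro prod_mono conjI prod_nonneg pair) auto
    also have "\<dots> = (A * growth N x ^ (2 * n)) ^ M"
      by (simp add: M_def power_sum)
    also have "\<dots> = A ^ M * growth N x ^ (2 * n * M)"
      by (simp add: power_mult_distrib power_mult)
    finally have "(\<Prod>l<N. exp (- (x l)\<^sup>2 / 2)) * (\<Prod>k<N. \<Prod>j<k. ((x k - x j)\<^sup>2 + \<epsilon>\<^sup>2) powr (\<beta> / 2))
        \<le> (\<Prod>l<N. exp (- (x l)\<^sup>2 / 2)) * (A ^ M * growth N x ^ (2 * n * M))"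
      by (intro mult_left_mono prod_nonneg) auto
    then show ?thesis by (simp add: reg_weight_def mult_ac)
  qed
  then show thesis using A1 by (intro that[of "A ^ M" "2 * n * M"]) auto
qed

section \<open>Integration by parts\<close>

text \<open>The class is closed under the ring operations and contains all power sums and, for
  \<epsilon> > 0, the drift; integrability of the expressions below thus reduces to following their
  syntax.\<close>

definition poly_bounded :: "nat \<Rightarrow> ((nat \<Rightarrow> real) \<Rightarrow> real) \<Rightarrow> bool" where
  "poly_bounded N f \<longleftrightarrow> f \<in> borel_measurable (PiM {..<N} (\<lambda>_. lborel)) \<and>
     (\<exists>C m. \<forall>x. \<bar>f x\<bar> \<le> C * growth N x ^ m)"

lemma poly_bounded_measurable: "poly_bounded N f \<Longrightarrow> f \<in> borel_measurable (PiM {..<N} (\<lambda>_. lborel))"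
  by (simp add: poly_bounded_def)

lemma poly_boundedE:
  assumes "poly_bounded N f"
  obtains C m where "0 \<le> C" "\<And>x. \<bar>f x\<bar> \<le> C * growth N x ^ m"
proof -
  obtain C m where C: "\<And>x. \<bar>f x\<bar> \<le> C * growth N x ^ m"
    using assms by (auto simp: poly_bounded_def)
  have "C * growth N x ^ m \<le> \<bar>C\<bar> * growth N x ^ m" for x
    using growth_ge_1[of N x] by (intro mult_right_mono) auto
  with C have "\<And>x. \<bar>f x\<bar> \<le> \<bar>C\<bar> * growth N x ^ m" by (meson order_trans)
  then show thesis by (intro that[of "\<bar>C\<bar>" m]) auto
qed

lemma poly_bounded_le:
  assumes "poly_bounded N f" "\<And>x. \<bar>g x\<bar> \<le> f x" "g \<in> borel_measurable (PiM {..<N} (\<lambda>_. lborel))"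
  shows "poly_bounded N g"
proof -
  obtain C m where "\<And>x. \<bar>f x\<bar> \<le> C * growth N x ^ m" using assms(1) by (auto simp: poly_bounded_def)
  with assms(2) have "\<bar>g x\<bar> \<le> C * growth N x ^ m" for x by (meson abs_ge_self order_trans)
  with assms(3) show ?thesis by (auto simp: poly_bounded_def)
qed

lemma poly_bounded_const: "poly_bounded N (\<lambda>_. c)"
proof -
  have "\<forall>x. \<bar>c\<bar> \<le> \<bar>c\<bar> * growth N x ^ 0" by simp
  then show ?thesis unfolding poly_bounded_def by (intro conjI borel_measurable_const) blast
qed

lemma poly_bounded_component: "j < N \<Longrightarrow> poly_bounded N (\<lambda>x. x j)"
  using abs_le_growth[of j N] component_measurable[of j N]
  by (auto simp: poly_bounded_def intro!: exI[of _ 1]) (smt (verit, best))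

lemma poly_bounded_abs: "poly_bounded N f \<Longrightarrow> poly_bounded N (\<lambda>x. \<bar>f x\<bar>)"
  by (auto simp: poly_bounded_def)

lemma poly_bounded_add:
  assumes "poly_bounded N f" "poly_bounded N g"
  shows "poly_bounded N (\<lambda>x. f x + g x)"
proof -
  obtain C m where C: "0 \<le> C" "\<And>x. \<bar>f x\<bar> \<le> C * growth N x ^ m" using assms(1) by (rule poly_boundedE) blast
  obtain D k where D: "0 \<le> D" "\<And>x. \<bar>g x\<bar> \<le> D * growth N x ^ k" using assms(2) by (rule poly_boundedE) blast
  have "\<bar>f x + g x\<bar> \<le> (C + D) * growth N x ^ (m + k)" for x
  proof -
    have "C * growth N x ^ m \<le> C * growth N x ^ (m + k)" "D * growth N x ^ k \<le> D * growth N x ^ (m + k)"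
      using growth_ge_1[of N x] C D by (auto intro!: mult_left_mono power_increasing)
    with C(2)[of x] D(2)[of x] show ?thesis by (simp add: distrib_right)
  qed
  then show ?thesis using assms by (auto simp: poly_bounded_def)
qed

lemma poly_bounded_mult:
  assumes "poly_bounded N f" "poly_bounded N g"
  shows "poly_bounded N (\<lambda>x. f x * g x)"
proof -
  obtain C m where C: "0 \<le> C" "\<And>x. \<bar>f x\<bar> \<le> C * growth N x ^ m" using assms(1) by (rule poly_boundedE) blast
  obtain D k where D: "0 \<le> D" "\<And>x. \<bar>g x\<bar> \<le> D * growth N x ^ k" using assms(2) by (rule poly_boundedE) blast
  have "\<bar>f x * g x\<bar> \<le> (C * D) * growth N x ^ (m + k)" for x
  proof -
    have "\<bar>f x\<bar> * \<bar>g x\<bar> \<le> (C * growth N x ^ m) * (D * growth N x ^ k)"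
      using growth_ge_1[of N x] C D by (intro mult_mono) auto
    then show ?thesis by (simp add: abs_mult power_add mult_ac)
  qed
  then show ?thesis using assms by (auto simp: poly_bounded_def)
qed

lemma poly_bounded_minus: "poly_bounded N f \<Longrightarrow> poly_bounded N (\<lambda>x. - f x)"
  using poly_bounded_mult[OF poly_bounded_const[of N "-1"]] by simp

lemma poly_bounded_diff: "poly_bounded N f \<Longrightarrow> poly_bounded N g \<Longrightarrow> poly_bounded N (\<lambda>x. f x - g x)"
  using poly_bounded_add[OF _ poly_bounded_minus] by simp

lemma poly_bounded_power: "poly_bounded N f \<Longrightarrow> poly_bounded N (\<lambda>x. f x ^ k)"
  by (induction k) (auto intro: poly_bounded_const poly_bounded_mult)

lemma poly_bounded_sum:
  "(\<And>i. i \<in> A \<Longrightarrow> poly_bounded N (f i)) \<Longrightarrow> poly_bounded N (\<lambda>x. \<Sum>i\<in>A. f i x)"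
  by (induction A rule: infinite_finite_induct) (auto intro: poly_bounded_const poly_bounded_add)

lemma poly_bounded_power_sum: "poly_bounded N (power_sum N p)"
proof -
  have "poly_bounded N (\<lambda>x. \<Sum>j<N. x j ^ p)"
    by (intro poly_bounded_sum poly_bounded_power poly_bounded_component) auto
  then show ?thesis by (simp add: power_sum_def[abs_def])
qed

lemmas poly_bounded_intros = poly_bounded_const poly_bounded_component poly_bounded_abs poly_bounded_add
  poly_bounded_mult poly_bounded_minus poly_bounded_diff poly_bounded_power poly_bounded_sum poly_bounded_power_sum

lemma integrable_poly_bounded_envelope:
  assumes "poly_bounded N f" "\<alpha> > -1"
  shows "integrable (PiM {..<N} (\<lambda>_. lborel)) (\<lambda>x. f x * envelope N \<alpha> x)"
proof -
  obtain C m where C: "0 \<le> C" "\<And>x. \<bar>f x\<bar> \<le> C * growth N x ^ m" using assms(1) by (rule poly_boundedE) blast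
  have "integrable (PiM {..<N} (\<lambda>_. lborel)) (\<lambda>x. C * (growth N x ^ m * envelope N \<alpha> x))"
    by (intro integrable_mult_right integrable_growth_envelope assms)
  moreover have "(\<lambda>x. f x * envelope N \<alpha> x) \<in> borel_measurable (PiM {..<N} (\<lambda>_. lborel))"
    using integrable_growth_envelope[OF assms(2), of N 0] poly_bounded_measurable[OF assms(1)]
    by (intro borel_measurable_times) auto
  moreover have "norm (f x * envelope N \<alpha> x) \<le> norm (C * (growth N x ^ m * envelope N \<alpha> x))" for x
  proof -
    have "\<bar>f x\<bar> * envelope N \<alpha> x \<le> C * growth N x ^ m * envelope N \<alpha> x"
      by (intro mult_right_mono C envelope_nonneg)
    also have "\<dots> \<le> \<bar>C * growth N x ^ m * envelope N \<alpha> x\<bar>" by simp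
    finally show ?thesis by (simp add: abs_mult envelope_nonneg mult_ac)
  qed
  ultimately show ?thesis by (rule Bochner_Integration.integrable_bound[OF _ _ AE_I2])
qed

lemma AE_reg_weight_le_envelope:
  assumes "N > 0" "0 \<le> \<epsilon>" "\<epsilon> \<le> 1"
  shows "AE x in PiM {..<N} (\<lambda>_. lborel). reg_weight N (2 * \<alpha> / real N) \<epsilon> x \<le> envelope N \<alpha> x"
  using AE_coordinates_distinct[of N] by eventually_elim (use reg_weight_le_envelope[OF assms] in blast)

lemma integrable_poly_bounded_reg_weight:
  assumes "poly_bounded N f" "\<alpha> > -1" "N > 0" "0 \<le> \<epsilon>" "\<epsilon> \<le> 1"
  shows "integrable (PiM {..<N} (\<lambda>_. lborel)) (\<lambda>x. f x * reg_weight N (2 * \<alpha> / real N) \<epsilon> x)"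
proof (rule Bochner_Integration.integrable_bound)
  show "integrable (PiM {..<N} (\<lambda>_. lborel)) (\<lambda>x. f x * envelope N \<alpha> x)"
    by (rule integrable_poly_bounded_envelope) fact+
  show "(\<lambda>x. f x * reg_weight N (2 * \<alpha> / real N) \<epsilon> x) \<in> borel_measurable (PiM {..<N} (\<lambda>_. lborel))"
    using poly_bounded_measurable[OF assms(1)] by measurable
  show "AE x in PiM {..<N} (\<lambda>_. lborel). norm (f x * reg_weight N (2 * \<alpha> / real N) \<epsilon> x) \<le> norm (f x * envelope N \<alpha> x)"
    using AE_reg_weight_le_envelope[OF assms(3-5), of \<alpha>]
    by eventually_elim (auto simp: abs_mult reg_weight_nonneg envelope_nonneg intro!: mult_left_mono)
qed

lemma line_decay:
  assumes "poly_bounded N f" "0 < \<epsilon>" "\<epsilon> \<le> 1" "i < N"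
  obtains C where "\<And>y. \<bar>f (x(i := y)) * reg_weight N \<beta> \<epsilon> (x(i := y))\<bar> \<le> C * exp (- y\<^sup>2 / 4)"
proof -
  obtain A m where A: "0 \<le> A" "\<And>x. \<bar>f x\<bar> \<le> A * growth N x ^ m" using assms(1) by (rule poly_boundedE) blast
  obtain B k where B: "0 \<le> B" "\<And>x. reg_weight N \<beta> \<epsilon> x \<le> B * growth N x ^ k * (\<Prod>l<N. exp (- (x l)\<^sup>2 / 2))"
    using reg_weight_le_growth[OF assms(2,3)] by blast
  define J where "J = {..<N} - {i}"
  have J: "{..<N} = insert i J" "finite J" "i \<notin> J" using assms(4) by (auto simp: J_def)
  have upd: "(\<Prod>l\<in>J. h ((x(i := y)) l)) = (\<Prod>l\<in>J. h (x l))" for h :: "real \<Rightarrow> real" and y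
    using J(3) by (intro prod.cong) auto
  define G where "G = (\<Prod>l\<in>J. 1 + \<bar>x l\<bar>)"
  define E where "E = (\<Prod>l\<in>J. exp (- (x l)\<^sup>2 / 2))"
  have G: "growth N (x(i := y)) = (1 + \<bar>y\<bar>) * G" for y
    unfolding growth_def G_def J(1) using J upd[of "\<lambda>t. 1 + \<bar>t\<bar>"] by (simp del: fun_upd_apply) simp
  have E: "(\<Prod>l<N. exp (- ((x(i := y)) l)\<^sup>2 / 2)) = exp (- y\<^sup>2 / 2) * E" for y
    unfolding E_def J(1) using J upd[of "\<lambda>t. exp (- t\<^sup>2 / 2)"] by (simp del: fun_upd_apply) simp
  have pos: "0 \<le> G" "0 \<le> E" unfolding G_def E_def by (auto intro!: prod_nonneg)
  define C where "C = A * B * G ^ (m + k) * E * exp ((real (m + k))\<^sup>2)"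
  have "\<bar>f (x(i := y)) * reg_weight N \<beta> \<epsilon> (x(i := y))\<bar> \<le> C * exp (- y\<^sup>2 / 4)" for y
  proof -
    have "\<bar>f (x(i := y))\<bar> * reg_weight N \<beta> \<epsilon> (x(i := y))
       \<le> (A * ((1 + \<bar>y\<bar>) * G) ^ m) * (B * ((1 + \<bar>y\<bar>) * G) ^ k * (exp (- y\<^sup>2 / 2) * E))"
      using A(2)[of "x(i := y)"] B(2)[of "x(i := y)"] A(1) B(1) pos unfolding G E
      by (intro mult_mono) (auto simp: reg_weight_nonneg)
    also have "\<dots> = A * B * G ^ (m + k) * E * ((1 + \<bar>y\<bar>) ^ (m + k) * exp (- y\<^sup>2 / 2))"
      unfolding power_mult_distrib power_add by (simp add: mult_ac)
    also have "\<dots> \<le> A * B * G ^ (m + k) * E * (exp ((real (m + k))\<^sup>2) * exp (- y\<^sup>2 / 4))"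
      using A(1) B(1) pos by (intro mult_left_mono gauss_poly_le) auto
    also have "\<dots> = C * exp (- y\<^sup>2 / 4)"
      unfolding C_def by (simp add: mult_ac)
    finally show ?thesis by (simp add: abs_mult reg_weight_nonneg)
  qed
  then show thesis by (rule that)
qed

text \<open>\<beta> times this is the logarithmic derivative of the regularised interaction in x i.
  The summand k = i is 0, so the index set need not omit it.\<close>

definition drift :: "nat \<Rightarrow> real \<Rightarrow> nat \<Rightarrow> (nat \<Rightarrow> real) \<Rightarrow> real" where
  "drift N \<epsilon> i x = (\<Sum>k<N. (x i - x k) / ((x i - x k)\<^sup>2 + \<epsilon>\<^sup>2))"

lemma poly_bounded_drift:
  assumes "0 < \<epsilon>" "i < N"
  shows "poly_bounded N (drift N \<epsilon> i)"
proof -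
  have "poly_bounded N (\<lambda>x. (x i - x k) / ((x i - x k)\<^sup>2 + \<epsilon>\<^sup>2))" if "k < N" for k
  proof (rule poly_bounded_le)
    show "poly_bounded N (\<lambda>x. \<bar>x i - x k\<bar> * (1 / \<epsilon>\<^sup>2))"
      using that assms by (intro poly_bounded_intros)
    show "\<bar>(x i - x k) / ((x i - x k)\<^sup>2 + \<epsilon>\<^sup>2)\<bar> \<le> \<bar>x i - x k\<bar> * (1 / \<epsilon>\<^sup>2)" for x :: "nat \<Rightarrow> real"
      using assms by (auto simp: abs_divide intro!: divide_left_mono mult_pos_pos add_nonneg_pos)
    show "(\<lambda>x. (x i - x k) / ((x i - x k)\<^sup>2 + \<epsilon>\<^sup>2)) \<in> borel_measurable (PiM {..<N} (\<lambda>_. lborel))"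
      using component_measurable[OF that] component_measurable[OF assms(2)] by measurable
  qed
  then have "poly_bounded N (\<lambda>x. \<Sum>k<N. (x i - x k) / ((x i - x k)\<^sup>2 + \<epsilon>\<^sup>2))"
    by (intro poly_bounded_sum) auto
  then show ?thesis by (simp add: drift_def[abs_def])
qed

text \<open>In exponential form the derivative of the product over pairs becomes a sum. Ordered
  pairs count every interaction twice, hence \<beta>/4 in place of \<beta>/2.\<close>

lemma reg_weight_exp:
  assumes "0 < \<epsilon>"
  shows "reg_weight N \<beta> \<epsilon> x =
    exp ((\<Sum>l<N. - (x l)\<^sup>2 / 2) + \<beta> / 4 * (\<Sum>i<N. \<Sum>j\<in>{..<N} - {i}. ln ((x i - x j)\<^sup>2 + \<epsilon>\<^sup>2)))"
proof -
  define u where "u i j = (x i - x j)\<^sup>2 + \<epsilon>\<^sup>2" for i j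
  have u: "u i j > 0" for i j unfolding u_def using assms by (intro add_nonneg_pos) auto
  have "(\<Prod>k<N. \<Prod>j<k. u k j powr (\<beta> / 2)) = (\<Prod>k<N. \<Prod>j<k. u k j powr (\<beta> / 4) * u j k powr (\<beta> / 4))"
    by (intro prod.cong refl) (simp add: u_def power2_commute flip: powr_add)
  also have "\<dots> = (\<Prod>i<N. \<Prod>j\<in>{..<N} - {i}. u i j powr (\<beta> / 4))"
    by (rule prod_off_diagonal[symmetric])
  also have "\<dots> = (\<Prod>i<N. \<Prod>j\<in>{..<N} - {i}. exp (\<beta> / 4 * ln (u i j)))"
    using u by (simp add: powr_def less_imp_neq[THEN not_sym])
  also have "\<dots> = exp (\<Sum>i<N. \<Sum>j\<in>{..<N} - {i}. \<beta> / 4 * ln (u i j))"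
    by (simp add: exp_sum)
  finally show ?thesis
    by (simp add: reg_weight_def exp_add exp_sum sum_distrib_left flip: u_def)
qed

lemma has_derivative_fun_upd:
  "((\<lambda>y. (x(i := y)) k) has_real_derivative (if k = i then 1 else 0)) (at y)"
  by (cases "k = i") auto

lemma reg_weight_has_derivative:
  assumes "0 < \<epsilon>" "i < N"
  shows "((\<lambda>y. reg_weight N \<beta> \<epsilon> (x(i := y))) has_real_derivative
     (- y + \<beta> * drift N \<epsilon> i (x(i := y))) * reg_weight N \<beta> \<epsilon> (x(i := y))) (at y)"
proof -
  define z where "z k y = (x(i := y)) k" for k y
  \<comment> \<open>The Kronecker symbol is the derivative of coordinate k along the line.\<close>
  define \<delta> where "\<delta> k = (if k = i then 1 else 0 :: real)" for k
  have z [derivative_intros]: "(z k has_real_derivative \<delta> k) (at y)" for k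
    unfolding z_def[abs_def] \<delta>_def by (rule has_derivative_fun_upd)
  define u where "u k j = (z k y - z j y)\<^sup>2 + \<epsilon>\<^sup>2" for k j
  have u: "u k j > 0" for k j unfolding u_def using assms by (intro add_nonneg_pos) auto
  have ln: "((\<lambda>y. ln ((z k y - z j y)\<^sup>2 + \<epsilon>\<^sup>2)) has_real_derivative
      2 * (\<delta> k * ((z k y - z j y) / u k j)) - 2 * (\<delta> j * ((z k y - z j y) / u k j))) (at y)" for k j
  proof -
    have "((\<lambda>y. (z k y - z j y)\<^sup>2 + \<epsilon>\<^sup>2) has_real_derivative 2 * (z k y - z j y) * (\<delta> k - \<delta> j)) (at y)"
      by (rule derivative_eq_intros z refl)+ simp
    from DERIV_chain2[OF DERIV_ln_divide[OF u[of k j, unfolded u_def]] this]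
    show ?thesis by (rule DERIV_cong) (simp add: u_def diff_divide_distrib algebra_simps)
  qed
  have sq: "((\<lambda>y. - (z l y)\<^sup>2 / 2) has_real_derivative - (\<delta> l * z l y)) (at y)" for l
    by (rule derivative_eq_intros refl | simp)+
  define d where "d k j = (z k y - z j y) / u k j" for k j
  have anti: "d j k = - d k j" for k j
    by (simp add: d_def u_def power2_commute[of "z j y"] minus_divide_left)
  have delta: "(\<Sum>k<N. \<delta> k * f k) = f i" for f
    using assms(2) by (simp add: \<delta>_def if_distrib[of "\<lambda>t. t * _"] cong: if_cong)
  \<comment> \<open>The diagonal may be added because \<open>d k k = 0\<close>. Row k = i and column
    j = i then contribute equally by antisymmetry of \<open>d\<close>; the resulting factor 4
    cancels the 4 in \<beta>/4.\<close>
  have "(\<Sum>k<N. \<Sum>j\<in>{..<N} - {k}. 2 * (\<delta> k * d k j) - 2 * (\<delta> j * d k j))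
      = (\<Sum>k<N. \<Sum>j<N. 2 * (\<delta> k * d k j) - 2 * (\<delta> j * d k j))"
    by (intro sum.cong sum.mono_neutral_left) (auto simp: d_def)
  also have "\<dots> = 2 * (\<Sum>k<N. \<delta> k * (\<Sum>j<N. d k j)) - 2 * (\<Sum>k<N. \<Sum>j<N. \<delta> j * d k j)"
    by (simp add: sum_subtractf sum_distrib_left)
  also have "(\<Sum>k<N. \<Sum>j<N. \<delta> j * d k j) = (\<Sum>k<N. d k i)"
    by (simp add: delta)
  also have "(\<Sum>k<N. d k i) = - (\<Sum>k<N. d i k)"
    by (subst anti) (simp add: sum_negf)
  also have "(\<Sum>k<N. \<delta> k * (\<Sum>j<N. d k j)) = (\<Sum>j<N. d i j)"
    by (rule delta)
  finally have pair_sum: "(\<Sum>k<N. \<Sum>j\<in>{..<N} - {k}. 2 * (\<delta> k * d k j) - 2 * (\<delta> j * d k j)) = 4 * (\<Sum>j<N. d i j)"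
    by simp
  have drift: "drift N \<epsilon> i (x(i := y)) = (\<Sum>j<N. d i j)"
    by (simp add: drift_def d_def u_def z_def)
  have zi: "z i y = y" by (simp add: z_def)
  define H where "H y = (\<Sum>l<N. - (z l y)\<^sup>2 / 2) + \<beta> / 4 * (\<Sum>k<N. \<Sum>j\<in>{..<N} - {k}. ln ((z k y - z j y)\<^sup>2 + \<epsilon>\<^sup>2))" for y
  have "(H has_real_derivative
      (\<Sum>l<N. - (\<delta> l * z l y)) + \<beta> / 4 * (\<Sum>k<N. \<Sum>j\<in>{..<N} - {k}. 2 * (\<delta> k * d k j) - 2 * (\<delta> j * d k j))) (at y)"
    unfolding H_def[abs_def] d_def by (intro DERIV_add DERIV_cmult DERIV_sum sq ln)
  also have "(\<Sum>l<N. - (\<delta> l * z l y)) = - y"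
    by (simp add: sum_negf delta zi)
  also have "- y + \<beta> / 4 * (\<Sum>k<N. \<Sum>j\<in>{..<N} - {k}. 2 * (\<delta> k * d k j) - 2 * (\<delta> j * d k j))
      = - y + \<beta> * drift N \<epsilon> i (x(i := y))"
    unfolding pair_sum drift by simp
  finally have "((\<lambda>y. exp (H y)) has_real_derivative exp (H y) * (- y + \<beta> * drift N \<epsilon> i (x(i := y)))) (at y)"
    by (rule DERIV_fun_exp)
  moreover have "reg_weight N \<beta> \<epsilon> (x(i := y)) = exp (H y)" for y
    unfolding reg_weight_exp[OF assms(1)] H_def z_def ..
  ultimately show ?thesis by (simp add: mult.commute)
qed

lemma isCont_fun_upd: "isCont (\<lambda>y. (x(i := y)) k) (y :: real)"
  by (rule DERIV_isCont[OF has_derivative_fun_upd])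

lemma isCont_drift:
  assumes "0 < \<epsilon>"
  shows "isCont (\<lambda>y. drift N \<epsilon> i (x(i := y))) y"
proof -
  have "((x(i := y)) i - (x(i := y)) k)\<^sup>2 + \<epsilon>\<^sup>2 \<noteq> 0" for y k
    using assms add_nonneg_pos[of "((x(i := y)) i - (x(i := y)) k)\<^sup>2" "\<epsilon>\<^sup>2"] by force
  then show ?thesis unfolding drift_def
    by (intro continuous_intros isCont_fun_upd) auto
qed

text \<open>The integrand is the derivative of \<open>P\<close> times the weight in direction i, so
  its integral already vanishes on each line, before the other coordinates are integrated.\<close>

lemma reg_weight_by_parts:
  assumes "\<alpha> > -1" "i < N" "0 < \<epsilon>" "\<epsilon> \<le> 1"
    and P: "poly_bounded N P" "poly_bounded N P'"
    and deriv: "\<And>x y. ((\<lambda>y. P (x(i := y))) has_real_derivative P' (x(i := y))) (at y)"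
    and cont: "\<And>x y. isCont (\<lambda>y. P' (x(i := y))) y"
  shows "(\<integral>x. (P' x + P x * (- x i + 2 * \<alpha> / real N * drift N \<epsilon> i x)) * reg_weight N (2 * \<alpha> / real N) \<epsilon> x
     \<partial>PiM {..<N} (\<lambda>_. lborel)) = 0"
proof -
  define \<beta> where "\<beta> = 2 * \<alpha> / real N"
  define Q where "Q x = P' x + P x * (- x i + \<beta> * drift N \<epsilon> i x)" for x
  define J where "J = {..<N} - {i}"
  have J: "{..<N} = insert i J" "finite J" "i \<notin> J" using assms(2) by (auto simp: J_def)
  have Q: "poly_bounded N Q"
    unfolding Q_def[abs_def] using assms by (intro poly_bounded_intros poly_bounded_drift)
  have "integrable (PiM {..<N} (\<lambda>_. lborel)) (\<lambda>x. Q x * reg_weight N \<beta> \<epsilon> x)"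
    unfolding \<beta>_def using assms Q by (intro integrable_poly_bounded_reg_weight) auto
  then have "(\<integral>x. Q x * reg_weight N \<beta> \<epsilon> x \<partial>PiM {..<N} (\<lambda>_. lborel))
     = (\<integral>x. (\<integral>y. Q (x(i := y)) * reg_weight N \<beta> \<epsilon> (x(i := y)) \<partial>lborel) \<partial>PiM J (\<lambda>_. lborel))"
    unfolding J(1) using J(2,3) by (intro lborel_product.product_integral_insert) auto
  also have "\<dots> = (\<integral>x. 0 \<partial>PiM J (\<lambda>_. lborel :: real measure))"
  proof (intro Bochner_Integration.integral_cong refl)
    fix x :: "nat \<Rightarrow> real"
    obtain C where C: "\<And>y. \<bar>P (x(i := y)) * reg_weight N \<beta> \<epsilon> (x(i := y))\<bar> \<le> C * exp (- y\<^sup>2 / 4)"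
      using line_decay[OF P(1) assms(3,4,2)] by blast
    obtain D where D: "\<And>y. \<bar>Q (x(i := y)) * reg_weight N \<beta> \<epsilon> (x(i := y))\<bar> \<le> D * exp (- y\<^sup>2 / 4)"
      using line_decay[OF Q assms(3,4,2)] by blast
    have isCont: "isCont (\<lambda>y. Q (x(i := y)) * reg_weight N \<beta> \<epsilon> (x(i := y))) y" for y
      unfolding Q_def
      by (intro continuous_intros cont DERIV_isCont[OF deriv] isCont_drift assms(3) isCont_fun_upd
           DERIV_isCont[OF reg_weight_has_derivative[OF assms(3,2)]])
    show "(\<integral>y. Q (x(i := y)) * reg_weight N \<beta> \<epsilon> (x(i := y)) \<partial>lborel) = 0"
    proof (rule integral_derivative_eq_0[OF _ isCont _ C])
      fix y
      show "((\<lambda>y. P (x(i := y)) * reg_weight N \<beta> \<epsilon> (x(i := y))) has_real_derivative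
         Q (x(i := y)) * reg_weight N \<beta> \<epsilon> (x(i := y))) (at y)"
        unfolding Q_def
        by (rule derivative_eq_intros deriv reg_weight_has_derivative[OF assms(3,2)] refl)+
           (simp add: algebra_simps)
    next
      show "integrable lborel (\<lambda>y. Q (x(i := y)) * reg_weight N \<beta> \<epsilon> (x(i := y)))"
      proof (rule Bochner_Integration.integrable_bound)
        show "integrable lborel (\<lambda>y::real. D * exp (- y\<^sup>2 / 4))"
          by (intro integrable_mult_right integrable_gauss)
        show "(\<lambda>y. Q (x(i := y)) * reg_weight N \<beta> \<epsilon> (x(i := y))) \<in> borel_measurable lborel"
          using isCont by (auto intro!: borel_measurable_continuous_onI continuous_at_imp_continuous_on)
        show "AE y in lborel. norm (Q (x(i := y)) * reg_weight N \<beta> \<epsilon> (x(i := y))) \<le> norm (D * exp (- y\<^sup>2 / 4))"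
          using D by (auto intro!: AE_I2 intro: order_trans[OF _ abs_ge_self])
      qed
    qed
  qed
  finally show ?thesis by (simp add: Q_def \<beta>_def)
qed

section \<open>The loop equation\<close>

text \<open>The quotient (a^p - b^p)/(a - b) in polynomial form: it is meaningful at a = b and
  expands into products of power sums.\<close>

definition divided_difference :: "nat \<Rightarrow> real \<Rightarrow> real \<Rightarrow> real" where
  "divided_difference p a b = (\<Sum>r<p. a ^ r * b ^ (p - 1 - r))"

lemma power_diff_divided_difference: "a ^ p - b ^ p = (a - b) * divided_difference p a b"
  unfolding divided_difference_def by (subst power_diff_sumr2) (simp add: mult.commute)

lemma sum_divided_difference:
  "(\<Sum>i<N. \<Sum>k<N. divided_difference p (x i) (x k)) = (\<Sum>r<p. power_sum N r x * power_sum N (p - 1 - r) x)"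
proof -
  have "(\<Sum>i<N. \<Sum>k<N. divided_difference p (x i) (x k))
      = (\<Sum>r<p. \<Sum>i<N. \<Sum>k<N. x i ^ r * x k ^ (p - 1 - r))"
    unfolding divided_difference_def
    by (subst sum.swap[where B = "{..<N}" and A = "{..<p}"], subst sum.swap[where B = "{..<N}" and A = "{..<p}"]) simp
  then show ?thesis by (simp add: power_sum_def sum_product)
qed

lemma divided_difference_same: "divided_difference p a a = real p * a ^ (p - 1)"
  by (simp add: divided_difference_def flip: power_add)

text \<open>The sum over i of the derivatives in direction i of
  \<open>x i ^ p * power_sum N q x\<close> times the weight, divided by the weight and symmetrised.
  At x i = x k the last quotient is 0 for every \<epsilon>, at \<epsilon> = 0 by the convention 0/0
  = 0; the diagonal is therefore absent and the limit \<epsilon> to 0 is pointwise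
  everywhere.\<close>

definition loop_kernel :: "nat \<Rightarrow> nat \<Rightarrow> nat \<Rightarrow> real \<Rightarrow> real \<Rightarrow> (nat \<Rightarrow> real) \<Rightarrow> real" where
  "loop_kernel N p q \<beta> \<epsilon> x =
     power_sum N q x * (real p * power_sum N (p - 1) x - power_sum N (p + 1) x)
     + real q * power_sum N (p + (q - 1)) x
     + \<beta> / 2 * power_sum N q x * (\<Sum>i<N. \<Sum>k<N. divided_difference p (x i) (x k)
         * ((x i - x k)\<^sup>2 / ((x i - x k)\<^sup>2 + \<epsilon>\<^sup>2)))"

text \<open>The kernel is antisymmetric under exchange of i and k, so averaging replaces
  \<open>x i ^ p\<close> by half of \<open>x i ^ p - x k ^ p\<close>, whose factor x i - x k
  compensates the singularity. The remaining quotient lies between 0 and 1 for all \<epsilon>, which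
  is what domination needs.\<close>

lemma sum_power_mult_drift:
  "(\<Sum>i<N. x i ^ p * drift N \<epsilon> i x) = (\<Sum>i<N. \<Sum>k<N. divided_difference p (x i) (x k)
         * ((x i - x k)\<^sup>2 / ((x i - x k)\<^sup>2 + \<epsilon>\<^sup>2))) / 2"
proof -
  define \<tau> where "\<tau> i k = (x i - x k) / ((x i - x k)\<^sup>2 + \<epsilon>\<^sup>2)" for i k
  define S where "S = (\<Sum>i<N. \<Sum>k<N. x i ^ p * \<tau> i k)"
  have anti: "\<tau> k i = - \<tau> i k" for i k
    by (simp add: \<tau>_def power2_commute[of "x k"] minus_divide_left)
  have "S = (\<Sum>i<N. \<Sum>k<N. x k ^ p * \<tau> k i)"
    unfolding S_def by (rule sum.swap)
  also have "\<dots> = - (\<Sum>i<N. \<Sum>k<N. x k ^ p * \<tau> i k)"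
    by (subst anti) (simp add: sum_negf)
  finally have "2 * S = (\<Sum>i<N. \<Sum>k<N. (x i ^ p - x k ^ p) * \<tau> i k)"
    by (simp add: S_def left_diff_distrib sum_subtractf)
  also have "\<dots> = (\<Sum>i<N. \<Sum>k<N. divided_difference p (x i) (x k)
         * ((x i - x k)\<^sup>2 / ((x i - x k)\<^sup>2 + \<epsilon>\<^sup>2)))"
    by (simp add: power_diff_divided_difference \<tau>_def power2_eq_square mult_ac)
  finally have "S = (\<Sum>i<N. \<Sum>k<N. divided_difference p (x i) (x k)
         * ((x i - x k)\<^sup>2 / ((x i - x k)\<^sup>2 + \<epsilon>\<^sup>2))) / 2"
    by simp
  moreover have "S = (\<Sum>i<N. x i ^ p * drift N \<epsilon> i x)"
    by (simp add: S_def drift_def \<tau>_def sum_distrib_left)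
  ultimately show ?thesis by simp
qed

lemma power_sum_has_derivative:
  assumes "i < N"
  shows "((\<lambda>y. power_sum N q (x(i := y))) has_real_derivative real q * y ^ (q - 1)) (at y)"
proof -
  have "((\<lambda>y. power_sum N q (x(i := y))) has_real_derivative
      (\<Sum>k<N. real q * (x(i := y)) k ^ (q - 1) * (if k = i then 1 else 0))) (at y)"
    unfolding power_sum_def
    by (intro DERIV_sum DERIV_cong[OF DERIV_power[OF has_derivative_fun_upd]]) auto
  also have "(\<Sum>k<N. real q * (x(i := y)) k ^ (q - 1) * (if k = i then 1 else 0))
      = (\<Sum>k<N. if k = i then real q * y ^ (q - 1) else 0)"
    by (intro sum.cong) auto
  also have "\<dots> = real q * y ^ (q - 1)" using assms by simp
  finally show ?thesis .
qed

lemma integral_loop_kernel_reg_weight: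
  assumes "\<alpha> > -1" "0 < \<epsilon>" "\<epsilon> \<le> 1"
  shows "(\<integral>x. loop_kernel N p q (2 * \<alpha> / real N) \<epsilon> x * reg_weight N (2 * \<alpha> / real N) \<epsilon> x
     \<partial>PiM {..<N} (\<lambda>_. lborel)) = 0"
proof -
  define \<beta> where "\<beta> = 2 * \<alpha> / real N"
  define P where "P i x = x i ^ p * power_sum N q x" for i and x :: "nat \<Rightarrow> real"
  \<comment> \<open>The second summand comes from the dependence of \<open>power_sum N q\<close> on
    x i. Summed over i it gives q S (p + q - 1), the inhomogeneous term of the covariance
    equation.\<close>
  define P' where "P' i x = real p * x i ^ (p - 1) * power_sum N q x + x i ^ p * (real q * x i ^ (q - 1))"
    for i and x :: "nat \<Rightarrow> real"
  define Q where "Q i x = P' i x + P i x * (- x i + \<beta> * drift N \<epsilon> i x)" for i x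
  have pb: "poly_bounded N (P i)" "poly_bounded N (P' i)" if "i < N" for i
    unfolding P_def[abs_def] P'_def[abs_def] using that by (intro poly_bounded_intros; simp)+
  have int: "integrable (PiM {..<N} (\<lambda>_. lborel)) (\<lambda>x. Q i x * reg_weight N \<beta> \<epsilon> x)" if "i < N" for i
    unfolding \<beta>_def using assms that pb[OF that] unfolding Q_def[abs_def]
    by (intro integrable_poly_bounded_reg_weight poly_bounded_intros poly_bounded_drift) auto
  have zero: "(\<integral>x. Q i x * reg_weight N \<beta> \<epsilon> x \<partial>PiM {..<N} (\<lambda>_. lborel)) = 0" if i: "i < N" for i
    unfolding Q_def \<beta>_def
  proof (rule reg_weight_by_parts[OF assms(1) i assms(2,3) pb[OF i]])
    fix x y
    show "((\<lambda>y. P i (x(i := y))) has_real_derivative P' i (x(i := y))) (at y)"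
    proof -
      have "((\<lambda>y. y ^ p * power_sum N q (x(i := y))) has_real_derivative
          real p * y ^ (p - Suc 0) * power_sum N q (x(i := y)) + real q * y ^ (q - 1) * y ^ p) (at y)"
        by (intro DERIV_mult power_sum_has_derivative[OF i] DERIV_pow)
      then show ?thesis by (simp add: P_def P'_def algebra_simps)
    qed
    show "isCont (\<lambda>y. P' i (x(i := y))) y"
      unfolding P'_def
      by (intro continuous_intros isCont_fun_upd DERIV_isCont[OF power_sum_has_derivative[OF i]])
  qed
  have "loop_kernel N p q \<beta> \<epsilon> x = (\<Sum>i<N. Q i x)" for x
  proof -
    have "(\<Sum>i<N. Q i x) = real p * power_sum N (p - 1) x * power_sum N q x
        + real q * power_sum N (p + (q - 1)) x - power_sum N (p + 1) x * power_sum N q x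
        + \<beta> * power_sum N q x * (\<Sum>i<N. x i ^ p * drift N \<epsilon> i x)"
      unfolding Q_def P'_def P_def power_sum_def[of N "p - 1"] power_sum_def[of N "p + 1"] power_sum_def[of N "p + (q - 1)"]
      by (simp add: sum.distrib sum_distrib_left sum_distrib_right sum_negf algebra_simps power_add sum_subtractf)
    then show ?thesis
      unfolding sum_power_mult_drift loop_kernel_def by (simp add: algebra_simps)
  qed
  then have "(\<integral>x. loop_kernel N p q \<beta> \<epsilon> x * reg_weight N \<beta> \<epsilon> x \<partial>PiM {..<N} (\<lambda>_. lborel))
     = (\<integral>x. (\<Sum>i<N. Q i x * reg_weight N \<beta> \<epsilon> x) \<partial>PiM {..<N} (\<lambda>_. lborel))"
    by (simp add: sum_distrib_right)
  also have "\<dots> = (\<Sum>i<N. \<integral>x. Q i x * reg_weight N \<beta> \<epsilon> x \<partial>PiM {..<N} (\<lambda>_. lborel))"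
    using int by (intro Bochner_Integration.integral_sum) auto
  also have "\<dots> = 0" using zero by simp
  finally show ?thesis by (simp add: \<beta>_def)
qed

lemma tendsto_reg_weight:
  assumes "\<forall>i<N. \<forall>j<N. i \<noteq> j \<longrightarrow> x i \<noteq> x j" "\<epsilon> \<longlonglongrightarrow> 0"
  shows "(\<lambda>n. reg_weight N \<beta> (\<epsilon> n) x) \<longlonglongrightarrow> reg_weight N \<beta> 0 x"
proof -
  have "(\<lambda>n. ((x k - x j)\<^sup>2 + (\<epsilon> n)\<^sup>2) powr (\<beta> / 2)) \<longlonglongrightarrow> ((x k - x j)\<^sup>2 + 0\<^sup>2) powr (\<beta> / 2)"
    if "k < N" "j < k" for k j
    using assms(1) that by (intro tendsto_intros assms(2)) auto
  note lim = this
  show ?thesis unfolding reg_weight_def by (intro tendsto_mult tendsto_const tendsto_prod lim) auto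
qed

lemma tendsto_loop_kernel:
  assumes "\<epsilon> \<longlonglongrightarrow> 0"
  shows "(\<lambda>n. loop_kernel N p q \<beta> (\<epsilon> n) x) \<longlonglongrightarrow> loop_kernel N p q \<beta> 0 x"
proof -
  have "(\<lambda>n. (x i - x k)\<^sup>2 / ((x i - x k)\<^sup>2 + (\<epsilon> n)\<^sup>2)) \<longlonglongrightarrow> (x i - x k)\<^sup>2 / ((x i - x k)\<^sup>2 + 0\<^sup>2)" for i k
  proof (cases "x i = x k")
    case False
    then show ?thesis by (intro tendsto_intros assms) auto
  qed simp
  note lim = this
  show ?thesis unfolding loop_kernel_def
    by (intro tendsto_add tendsto_mult tendsto_sum tendsto_const lim)
qed

lemma loop_kernel_bound:
  obtains B where "poly_bounded N B" "\<And>\<epsilon> x. \<bar>loop_kernel N p q \<beta> \<epsilon> x\<bar> \<le> B x"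
proof -
  define B where "B x = \<bar>power_sum N q x * (real p * power_sum N (p - 1) x - power_sum N (p + 1) x)
     + real q * power_sum N (p + (q - 1)) x\<bar>
     + \<bar>\<beta> / 2 * power_sum N q x\<bar> * (\<Sum>i<N. \<Sum>k<N. \<bar>divided_difference p (x i) (x k)\<bar>)" for x :: "nat \<Rightarrow> real"
  have "poly_bounded N B"
    unfolding B_def[abs_def] divided_difference_def by (intro poly_bounded_intros; simp)
  moreover have "\<bar>loop_kernel N p q \<beta> \<epsilon> x\<bar> \<le> B x" for \<epsilon> x
  proof -
    have "\<bar>t\<^sup>2 / (t\<^sup>2 + \<epsilon>\<^sup>2)\<bar> \<le> 1" for t :: real
    proof (cases "t\<^sup>2 + \<epsilon>\<^sup>2 = 0")
      case False
      then have "t\<^sup>2 + \<epsilon>\<^sup>2 > 0" by (simp add: order.strict_iff_order)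
      then show ?thesis by simp
    qed simp
    then have "\<bar>d * (t\<^sup>2 / (t\<^sup>2 + \<epsilon>\<^sup>2))\<bar> \<le> \<bar>d\<bar>" for d t :: real
      unfolding abs_mult by (intro mult_left_le) auto
    then have "\<bar>\<Sum>i<N. \<Sum>k<N. divided_difference p (x i) (x k)
         * ((x i - x k)\<^sup>2 / ((x i - x k)\<^sup>2 + \<epsilon>\<^sup>2))\<bar> \<le> (\<Sum>i<N. \<Sum>k<N. \<bar>divided_difference p (x i) (x k)\<bar>)"
      by (intro order_trans[OF sum_abs] sum_mono)
    then show ?thesis unfolding loop_kernel_def B_def
      by (intro order_trans[OF abs_triangle_ineq] add_mono order_refl) (simp add: abs_mult mult_left_mono)
  qed
  ultimately show thesis by (rule that)
qed

lemma loop_kernel_measurable: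
  "loop_kernel N p q \<beta> \<epsilon> \<in> borel_measurable (PiM {..<N} (\<lambda>_. lborel))"
proof -
  have pair: "(\<lambda>x. divided_difference p (x i) (x k) * ((x i - x k)\<^sup>2 / ((x i - x k)\<^sup>2 + \<epsilon>\<^sup>2)))
      \<in> borel_measurable (PiM {..<N} (\<lambda>_. lborel))" if "i < N" "k < N" for i k
    unfolding divided_difference_def
    using component_measurable[OF that(1)] component_measurable[OF that(2)] by measurable
  show ?thesis unfolding loop_kernel_def[abs_def]
    by (intro pair borel_measurable_add borel_measurable_diff borel_measurable_times borel_measurable_sum
         borel_measurable_const poly_bounded_measurable[OF poly_bounded_power_sum]) auto
qed

lemma integral_loop_kernel_0:
  assumes "\<alpha> > -1" "N > 0"
  shows "(\<integral>x. loop_kernel N p q (2 * \<alpha> / real N) 0 x * gbe_weight N (2 * \<alpha> / real N) x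
     \<partial>PiM {..<N} (\<lambda>_. lborel)) = 0"
proof -
  define \<beta> where "\<beta> = 2 * \<alpha> / real N"
  define \<epsilon> where "\<epsilon> n = 1 / real (Suc n)" for n
  have \<epsilon>: "0 < \<epsilon> n" "\<epsilon> n \<le> 1" for n by (auto simp: \<epsilon>_def)
  have lim: "\<epsilon> \<longlonglongrightarrow> 0" unfolding \<epsilon>_def[abs_def] by (rule lim_1_over_n[THEN LIMSEQ_Suc])
  obtain B where B: "poly_bounded N B" "\<And>\<epsilon> x. \<bar>loop_kernel N p q \<beta> \<epsilon> x\<bar> \<le> B x"
    by (rule loop_kernel_bound) blast
  have "(\<lambda>n. \<integral>x. loop_kernel N p q \<beta> (\<epsilon> n) x * reg_weight N \<beta> (\<epsilon> n) x \<partial>PiM {..<N} (\<lambda>_. lborel))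
     \<longlonglongrightarrow> (\<integral>x. loop_kernel N p q \<beta> 0 x * reg_weight N \<beta> 0 x \<partial>PiM {..<N} (\<lambda>_. lborel))"
  proof (rule integral_dominated_convergence)
    show "integrable (PiM {..<N} (\<lambda>_. lborel)) (\<lambda>x. B x * envelope N \<alpha> x)"
      by (rule integrable_poly_bounded_envelope[OF B(1) assms(1)])
    show "AE x in PiM {..<N} (\<lambda>_. lborel). (\<lambda>n. loop_kernel N p q \<beta> (\<epsilon> n) x * reg_weight N \<beta> (\<epsilon> n) x)
        \<longlonglongrightarrow> loop_kernel N p q \<beta> 0 x * reg_weight N \<beta> 0 x"
      using AE_coordinates_distinct[of N]
      by eventually_elim (intro tendsto_mult tendsto_loop_kernel tendsto_reg_weight lim)
    show "AE x in PiM {..<N} (\<lambda>_. lborel). norm (loop_kernel N p q \<beta> (\<epsilon> n) x * reg_weight N \<beta> (\<epsilon> n) x)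
        \<le> B x * envelope N \<alpha> x" for n
      using AE_reg_weight_le_envelope[OF assms(2) less_imp_le[OF \<epsilon>(1)] \<epsilon>(2), of \<alpha> n, folded \<beta>_def]
    proof eventually_elim
      case (elim x)
      have "0 \<le> B x" using B(2)[of 0 x] by linarith
      with elim B(2)[of "\<epsilon> n" x] show ?case
        by (auto simp: abs_mult reg_weight_nonneg intro!: mult_mono)
    qed
  qed (intro borel_measurable_times loop_kernel_measurable reg_weight_measurable)+
  moreover have "(\<integral>x. loop_kernel N p q \<beta> (\<epsilon> n) x * reg_weight N \<beta> (\<epsilon> n) x \<partial>PiM {..<N} (\<lambda>_. lborel)) = 0" for n
    unfolding \<beta>_def by (intro integral_loop_kernel_reg_weight assms \<epsilon>)
  ultimately show ?thesis
    by (simp add: \<beta>_def reg_weight_0 LIMSEQ_const_iff)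
qed

text \<open>Without coincidences the quotient is the indicator of i \<noteq> k. Completing the
  double sum produces the products of power sums, and the diagonal to be subtracted is the
  derivative of t^p summed over the points.\<close>

lemma loop_kernel_0:
  assumes "\<forall>i<N. \<forall>j<N. i \<noteq> j \<longrightarrow> x i \<noteq> x j"
  shows "loop_kernel N p q \<beta> 0 x =
     power_sum N q x * (real p * power_sum N (p - 1) x - power_sum N (p + 1) x)
     + real q * power_sum N (p + (q - 1)) x
     + \<beta> / 2 * power_sum N q x * ((\<Sum>r<p. power_sum N r x * power_sum N (p - 1 - r) x) - real p * power_sum N (p - 1) x)"
proof -
  have "(\<Sum>i<N. \<Sum>k<N. divided_difference p (x i) (x k) * ((x i - x k)\<^sup>2 / ((x i - x k)\<^sup>2 + 0\<^sup>2)))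
      = (\<Sum>i<N. \<Sum>k<N. divided_difference p (x i) (x k) - (if k = i then divided_difference p (x i) (x i) else 0))"
    using assms by (intro sum.cong refl) auto
  also have "\<dots> = (\<Sum>i<N. \<Sum>k<N. divided_difference p (x i) (x k)) - (\<Sum>i<N. divided_difference p (x i) (x i))"
    by (simp add: sum_subtractf)
  also have "\<dots> = (\<Sum>r<p. power_sum N r x * power_sum N (p - 1 - r) x) - real p * power_sum N (p - 1) x"
    by (simp only: sum_divided_difference divided_difference_same power_sum_def sum_distrib_left)
  finally show ?thesis unfolding loop_kernel_def by simp
qed

section \<open>The ensemble as a probability measure\<close>

lemma gbe_weight_nonneg: "0 \<le> gbe_weight N \<beta> x"
  using reg_weight_nonneg[of N \<beta> 0 x] by (simp add: reg_weight_0)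

lemma gbe_weight_measurable [measurable]:
  "gbe_weight N \<beta> \<in> borel_measurable (PiM {..<N} (\<lambda>_. lborel))"
  using reg_weight_measurable[of N \<beta> 0] by (simp add: reg_weight_0)

lemma integrable_gbe_weight:
  assumes "poly_bounded N f" "\<alpha> > -1" "N > 0"
  shows "integrable (PiM {..<N} (\<lambda>_. lborel)) (\<lambda>x. f x * gbe_weight N (2 * \<alpha> / real N) x)"
  using integrable_poly_bounded_reg_weight[OF assms, of 0] by (simp add: reg_weight_0)

text \<open>The weight is positive off the coincidence hyperplanes; a zero integral would therefore
  make the whole space null, which Lebesgue measure excludes.\<close>

lemma gbe_norm_pos:
  assumes "\<alpha> > -1" "N > 0"
  shows "gbe_norm N (2 * \<alpha> / real N) > 0"
proof -
  define w where "w = gbe_weight N (2 * \<alpha> / real N)"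
  have int: "integrable (PiM {..<N} (\<lambda>_. lborel)) w"
    using integrable_gbe_weight[OF poly_bounded_const[of N 1] assms] by (simp add: w_def)
  have pos: "AE x in PiM {..<N} (\<lambda>_. lborel). w x > 0"
    using AE_coordinates_distinct[of N]
    by eventually_elim (auto simp: w_def gbe_weight_def intro!: mult_pos_pos prod_pos)
  have "(\<integral>x. w x \<partial>PiM {..<N} (\<lambda>_. lborel)) \<noteq> 0"
  proof
    assume "(\<integral>x. w x \<partial>PiM {..<N} (\<lambda>_. lborel)) = 0"
    then have "AE x in PiM {..<N} (\<lambda>_. lborel). w x = 0"
      using int by (subst (asm) integral_nonneg_eq_0_iff_AE) (auto simp: w_def gbe_weight_nonneg)
    with pos have "AE x in PiM {..<N} (\<lambda>_. lborel :: real measure). False"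
      by eventually_elim simp
    then have "emeasure (PiM {..<N} (\<lambda>_. lborel :: real measure)) (space (PiM {..<N} (\<lambda>_. lborel :: real measure))) = 0"
      by (simp add: AE_iff_measurable[OF _ refl])
    then have "emeasure (PiM {..<N} (\<lambda>_. lborel :: real measure)) (Pi\<^sub>E {..<N} (\<lambda>_. UNIV)) = 0"
      by (simp add: space_PiM)
    then show False
      by (subst (asm) lborel_product.emeasure_PiM) auto
  qed
  moreover have "(\<integral>x. w x \<partial>PiM {..<N} (\<lambda>_. lborel)) \<ge> 0"
    by (intro Bochner_Integration.integral_nonneg) (simp add: w_def gbe_weight_nonneg)
  ultimately show ?thesis by (simp add: gbe_norm_def w_def)
qed

lemma
  assumes "poly_bounded N f" "\<alpha> > -1" "N > 0"
  shows integrable_gbe: "integrable (gbe_ht \<alpha> N) f"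
    and integral_gbe: "(\<integral>x. f x \<partial>gbe_ht \<alpha> N) =
      (\<integral>x. f x * gbe_weight N (2 * \<alpha> / real N) x \<partial>PiM {..<N} (\<lambda>_. lborel)) / gbe_norm N (2 * \<alpha> / real N)"
proof -
  define \<beta> where "\<beta> = 2 * \<alpha> / real N"
  have Z: "gbe_norm N \<beta> > 0" using gbe_norm_pos[OF assms(2,3)] by (simp add: \<beta>_def)
  have [measurable]: "f \<in> borel_measurable (PiM {..<N} (\<lambda>_. lborel))"
    by (rule poly_bounded_measurable) fact
  have int: "integrable (PiM {..<N} (\<lambda>_. lborel)) (\<lambda>x. f x * gbe_weight N \<beta> x / gbe_norm N \<beta>)"
    using integrable_gbe_weight[OF assms] by (auto simp: \<beta>_def)
  show "integrable (gbe_ht \<alpha> N) f"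
    unfolding gbe_def \<beta>_def[symmetric] using Z int
    by (subst integrable_density) (auto simp: gbe_weight_nonneg mult.commute[of "gbe_weight N \<beta> _"])
  have "(\<integral>x. f x \<partial>gbe N \<beta>) = (\<integral>x. f x * gbe_weight N \<beta> x / gbe_norm N \<beta> \<partial>PiM {..<N} (\<lambda>_. lborel))"
    unfolding gbe_def using Z by (subst integral_density) (auto simp: gbe_weight_nonneg mult.commute[of "gbe_weight N \<beta> _"])
  then show "(\<integral>x. f x \<partial>gbe_ht \<alpha> N) =
      (\<integral>x. f x * gbe_weight N (2 * \<alpha> / real N) x \<partial>PiM {..<N} (\<lambda>_. lborel)) / gbe_norm N (2 * \<alpha> / real N)"
    by (simp add: \<beta>_def)
qed

lemma integral_gbe_const:
  assumes "\<alpha> > -1" "N > 0"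
  shows "(\<integral>x. c \<partial>gbe_ht \<alpha> N) = (c :: real)"
  using integral_gbe[OF poly_bounded_const assms, of c] gbe_norm_pos[OF assms]
  by (simp add: gbe_norm_def)

text \<open>Exact for every N > 0, with \<beta>/2 = \<alpha>/N. The truncated indices
  \<open>p - 1\<close> at p = 0 and \<open>q - 1\<close> at q = 0 occur only under a coefficient 0
  or in an empty sum.\<close>

lemma loop_equation:
  assumes "\<alpha> > -1" "N > 0"
  shows "(\<integral>x. power_sum N q x * (real p * power_sum N (p - 1) x - power_sum N (p + 1) x)
     + real q * power_sum N (p + (q - 1)) x
     + \<alpha> / real N * power_sum N q x * ((\<Sum>r<p. power_sum N r x * power_sum N (p - 1 - r) x)
         - real p * power_sum N (p - 1) x) \<partial>gbe_ht \<alpha> N) = 0"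
    (is "integral\<^sup>L _ ?f = 0")
proof -
  have "(\<integral>x. ?f x * gbe_weight N (2 * \<alpha> / real N) x \<partial>PiM {..<N} (\<lambda>_. lborel))
     = (\<integral>x. loop_kernel N p q (2 * \<alpha> / real N) 0 x * gbe_weight N (2 * \<alpha> / real N) x \<partial>PiM {..<N} (\<lambda>_. lborel))"
  proof (rule integral_cong_AE)
    show "AE x in PiM {..<N} (\<lambda>_. lborel). ?f x * gbe_weight N (2 * \<alpha> / real N) x
        = loop_kernel N p q (2 * \<alpha> / real N) 0 x * gbe_weight N (2 * \<alpha> / real N) x"
      using AE_coordinates_distinct[of N] by eventually_elim (simp add: loop_kernel_0)
    show "(\<lambda>x. ?f x * gbe_weight N (2 * \<alpha> / real N) x) \<in> borel_measurable (PiM {..<N} (\<lambda>_. lborel))"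
      by (intro borel_measurable_times poly_bounded_measurable poly_bounded_intros gbe_weight_measurable)
    show "(\<lambda>x. loop_kernel N p q (2 * \<alpha> / real N) 0 x * gbe_weight N (2 * \<alpha> / real N) x)
        \<in> borel_measurable (PiM {..<N} (\<lambda>_. lborel))"
      by (intro borel_measurable_times loop_kernel_measurable gbe_weight_measurable)
  qed
  also have "\<dots> = 0" by (rule integral_loop_kernel_0[OF assms])
  finally have zero: "(\<integral>x. ?f x * gbe_weight N (2 * \<alpha> / real N) x \<partial>PiM {..<N} (\<lambda>_. lborel)) = 0" .
  have "poly_bounded N ?f" by (intro poly_bounded_intros)
  from integral_gbe[OF this assms] show ?thesis unfolding zero by simp
qed

section \<open>Cumulants\<close>

text \<open>Partitions are classified by the block containing a, with \<open>B\<close> the rest of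
  that block. This gives a recursion that enumerates the partitions of small sets.\<close>

lemma partition_on_insert_iff:
  assumes "a \<notin> A"
  shows "partition_on (insert a A) P \<longleftrightarrow> (\<exists>B Q. B \<subseteq> A \<and> partition_on (A - B) Q \<and> P = insert (insert a B) Q)"
proof
  assume P: "partition_on (insert a A) P"
  then obtain p where p: "p \<in> P" "a \<in> p" by (auto simp: partition_on_def)
  define Q where "Q = P - {p}"
  have P_eq: "P = insert p Q" using p by (auto simp: Q_def)
  have disj: "disjnt p (\<Union>Q)"
    using P p unfolding partition_on_def disjoint_def Q_def disjnt_def by blast
  have "partition_on (insert a A - p) Q" "p \<subseteq> insert a A"
    using P unfolding P_eq partition_on_insert[OF disj] by auto
  moreover have "insert a A - p = A - (p - {a})" "insert a (p - {a}) = p"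
    using p assms by auto
  ultimately show "\<exists>B Q. B \<subseteq> A \<and> partition_on (A - B) Q \<and> P = insert (insert a B) Q"
    using P_eq by (intro exI[of _ "p - {a}"] exI[of _ Q]) auto
next
  assume "\<exists>B Q. B \<subseteq> A \<and> partition_on (A - B) Q \<and> P = insert (insert a B) Q"
  then obtain B Q where BQ: "B \<subseteq> A" "partition_on (A - B) Q" "P = insert (insert a B) Q" by blast
  have "disjnt (insert a B) (\<Union>Q)" using partition_onD1[OF BQ(2)] assms by (auto simp: disjnt_def)
  moreover have "insert a A - insert a B = A - B" using assms by auto
  ultimately show "partition_on (insert a A) P"
    using BQ by (simp add: partition_on_insert) auto
qed

lemma partitions_insert:
  assumes "a \<notin> A"
  shows "{P. partition_on (insert a A) P} = (\<Union>B\<in>Pow A. insert (insert a B) ` {Q. partition_on (A - B) Q})"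
  using partition_on_insert_iff[OF assms] by auto

lemma partitions_empty: "{P. partition_on {} P} = {{}}"
  by (simp add: partition_on_empty)

lemma partitions_1: "{P. partition_on {a} P} = {{{a}}}"
  by (simp add: partitions_insert partitions_empty)

lemma partitions_2: "a \<noteq> b \<Longrightarrow> {P. partition_on {a, b} P} = {{{a, b}}, {{a}, {b}}}"
  by (auto simp: partitions_insert partitions_empty partitions_1 Pow_insert)

lemma partitions_3:
  assumes "a \<noteq> b" "a \<noteq> c" "b \<noteq> c"
  shows "{P. partition_on {a, b, c} P}
    = {{{a, b, c}}, {{a}, {b, c}}, {{a, b}, {c}}, {{a, c}, {b}}, {{a}, {b}, {c}}}"
  using assms
  by (auto simp: partitions_insert partitions_empty partitions_1 partitions_2 Pow_insert insert_Diff_if)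

lemma sum_partitions_3:
  fixes F :: "'i set set \<Rightarrow> real"
  assumes ne: "a \<noteq> b" "a \<noteq> c" "b \<noteq> c"
  shows "(\<Sum>P | partition_on {a, b, c} P. F P)
    = F {{a, b, c}} + F {{a}, {b, c}} + F {{a, b}, {c}} + F {{a, c}, {b}} + F {{a}, {b}, {c}}"
proof -
  \<comment> \<open>Expanding the sum requires the five partitions to be pairwise distinct; the
    record of which pairs share a block separates them.\<close>
  define joined where "joined P = ((\<exists>B\<in>P. a \<in> B \<and> b \<in> B), (\<exists>B\<in>P. a \<in> B \<and> c \<in> B), (\<exists>B\<in>P. b \<in> B \<and> c \<in> B))"
    for P :: "'i set set"
  have joined: "joined {{a, b, c}} = (True, True, True)" "joined {{a}, {b, c}} = (False, False, True)"
    "joined {{a, b}, {c}} = (True, False, False)" "joined {{a, c}, {b}} = (False, True, False)"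
    "joined {{a}, {b}, {c}} = (False, False, False)"
    using ne by (simp_all add: joined_def)
  have neq: "P \<noteq> Q" if "joined P \<noteq> joined Q" for P Q using that by blast
  have "{{a, b, c}} \<notin> {{{a}, {b, c}}, {{a, b}, {c}}, {{a, c}, {b}}, {{a}, {b}, {c}}}"
    "{{a}, {b, c}} \<notin> {{{a, b}, {c}}, {{a, c}, {b}}, {{a}, {b}, {c}}}"
    "{{a, b}, {c}} \<notin> {{{a, c}, {b}}, {{a}, {b}, {c}}}"
    "{{a, c}, {b}} \<notin> {{{a}, {b}, {c}}}"
    unfolding insert_iff empty_iff de_Morgan_disj by (intro conjI neq; simp add: joined)+
  then show ?thesis
    unfolding partitions_3[OF ne] by (simp only: sum.insert finite.intros sum.empty empty_iff not_False_eq_True add.assoc add_0_right)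
qed

lemma joint_cumulant_1:
  fixes X :: "nat \<Rightarrow> 'a \<Rightarrow> real"
  shows "joint_cumulant M {..<1} X = (\<integral>x. X 0 x \<partial>M)"
proof -
  have "{..<1::nat} = {0}" by auto
  then show ?thesis unfolding joint_cumulant_def by (simp only: partitions_1) simp
qed

lemma joint_cumulant_2:
  fixes X :: "nat \<Rightarrow> 'a \<Rightarrow> real"
  shows "joint_cumulant M {..<2} X = (\<integral>x. X 0 x * X 1 x \<partial>M) - (\<integral>x. X 0 x \<partial>M) * (\<integral>x. X 1 x \<partial>M)"
proof -
  have "{..<2::nat} = {0, 1}" by auto
  then show ?thesis unfolding joint_cumulant_def by (simp only: partitions_2[OF zero_neq_one]) (simp add: doubleton_eq_iff)
qed

lemma joint_cumulant_3:
  fixes X :: "nat \<Rightarrow> 'a \<Rightarrow> real"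
  shows "joint_cumulant M {..<3} X = (\<integral>x. X 0 x * X 1 x * X 2 x \<partial>M)
     - (\<integral>x. X 0 x \<partial>M) * (\<integral>x. X 1 x * X 2 x \<partial>M)
     - (\<integral>x. X 0 x * X 1 x \<partial>M) * (\<integral>x. X 2 x \<partial>M)
     - (\<integral>x. X 0 x * X 2 x \<partial>M) * (\<integral>x. X 1 x \<partial>M)
     + 2 * (\<integral>x. X 0 x \<partial>M) * (\<integral>x. X 1 x \<partial>M) * (\<integral>x. X 2 x \<partial>M)"
proof -
  have "{..<3::nat} = {0, 1, 2}" by auto
  moreover have "(0::nat) \<noteq> 1" "(0::nat) \<noteq> 2" "(1::nat) \<noteq> 2" by auto
  note sum_partitions_3[OF this]
  ultimately show ?thesis unfolding joint_cumulant_def by (simp only:) (simp add: doubleton_eq_iff card_insert_if mult.assoc)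
qed

lemma covariance_eq:
  fixes X Y :: "'a \<Rightarrow> real"
  assumes "integrable M X" "integrable M Y" "integrable M (\<lambda>x. X x * Y x)"
    and const: "\<And>c::real. integrable M (\<lambda>x. c)" "\<And>c::real. (\<integral>x. c \<partial>M) = c"
  shows "covariance M X Y = (\<integral>x. X x * Y x \<partial>M) - (\<integral>x. X x \<partial>M) * (\<integral>x. Y x \<partial>M)"
proof -
  define a b where "a = (\<integral>x. X x \<partial>M)" and "b = (\<integral>x. Y x \<partial>M)"
  have "covariance M X Y = (\<integral>x. X x * Y x - a * Y x - b * X x + a * b \<partial>M)"
    unfolding covariance_def a_def b_def by (intro Bochner_Integration.integral_cong refl) (simp add: algebra_simps)
  also have "\<dots> = (\<integral>x. X x * Y x \<partial>M) - a * (\<integral>x. Y x \<partial>M) - b * (\<integral>x. X x \<partial>M) + a * b"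
    using assms by simp
  finally show ?thesis by (simp add: a_def b_def)
qed

text \<open>Recovers both coefficients of an expansion as limits: this makes them unique and turns
  comparison of coefficients into passage to the limit.\<close>

lemma bigo_first_order_tendsto:
  fixes f :: "nat \<Rightarrow> real"
  assumes "(\<lambda>N. f N - (a + b / real N)) \<in> O(\<lambda>N. 1 / real N ^ 2)"
  shows "(\<lambda>N. real N * (f N - a)) \<longlonglongrightarrow> b" "f \<longlonglongrightarrow> a"
proof -
  obtain c where c: "eventually (\<lambda>N. norm (f N - (a + b / real N)) \<le> c * norm (1 / real N ^ 2)) at_top"
    using assms by (auto elim: landau_o.bigE)
  have "(\<lambda>N. real N * (f N - a) - b) \<longlonglongrightarrow> 0"
  proof (rule Lim_null_comparison)
    show "eventually (\<lambda>N. norm (real N * (f N - a) - b) \<le> c / real N) at_top"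
      using c eventually_gt_at_top[of 0]
    proof eventually_elim
      case (elim N)
      have "real N * (f N - a) - b = real N * (f N - (a + b / real N))"
        using elim by (simp add: field_simps)
      then have "norm (real N * (f N - a) - b) = real N * norm (f N - (a + b / real N))"
        by (simp add: abs_mult)
      also have "\<dots> \<le> real N * (c * norm (1 / real N ^ 2))"
        using elim by (intro mult_left_mono) auto
      also have "\<dots> = c / real N" using elim by (simp add: power2_eq_square)
      finally show ?case .
    qed
    show "(\<lambda>N. c / real N) \<longlonglongrightarrow> 0" by real_asymp
  qed
  then show lim: "(\<lambda>N. real N * (f N - a)) \<longlonglongrightarrow> b"
    by (simp add: LIM_zero_iff)
  have "(\<lambda>N. real N * (f N - a) * (1 / real N)) \<longlonglongrightarrow> b * 0"
    by (intro tendsto_mult lim lim_1_over_n)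
  moreover have "eventually (\<lambda>N. real N * (f N - a) * (1 / real N) = f N - a) at_top"
    using eventually_gt_at_top[of 0] by eventually_elim simp
  ultimately have "(\<lambda>N. f N - a) \<longlonglongrightarrow> 0"
    by (simp add: Lim_transform_eventually)
  then show "f \<longlonglongrightarrow> a" by (simp add: LIM_zero_iff)
qed

section \<open>Reindexing of finite sums\<close>

lemma sum_atMost_reflect: "(\<Sum>r\<le>n. f r (n - r)) = (\<Sum>r\<le>n. f (n - r) r)" for n :: nat
  by (rule sum.reindex_bij_witness[of _ "\<lambda>r. n - r" "\<lambda>r. n - r"]) auto

lemma sum_triangle_swap: "(\<Sum>i\<le>m. \<Sum>r\<le>m - i. f i r) = (\<Sum>r\<le>m. \<Sum>i\<le>m - r. f i r)" for m :: nat
  unfolding sum.Sigma[OF finite_atMost ballI[OF finite_atMost]]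
  by (rule sum.reindex_bij_witness[of _ "\<lambda>(r, i). (i, r)" "\<lambda>(i, r). (r, i)"]) auto

lemma sum_atMost_even:
  fixes f :: "nat \<Rightarrow> 'a :: comm_monoid_add"
  assumes "\<And>k. f (2 * k + 1) = 0"
  shows "(\<Sum>r\<le>2 * n. f r) = (\<Sum>s\<le>n. f (2 * s))"
proof (induction n)
  case (Suc n)
  have "(\<Sum>r\<le>2 * Suc n. f r) = (\<Sum>r\<le>2 * n. f r) + f (2 * n + 1) + f (2 * Suc n)"
    by (simp add: add.assoc)
  then show ?case using Suc assms by simp
qed simp

lemma covariance_power_sum_commute:
  "covariance M (power_sum N p) (power_sum N q) = covariance M (power_sum N q) (power_sum N p)"
  by (simp add: covariance_def mult.commute)

lemma power_sum_0: "power_sum N 0 = (\<lambda>_. real N)"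
  by (simp add: power_sum_def fun_eq_iff)

section \<open>Loop equations for means and covariances at finite N\<close>

context
  fixes \<alpha> :: real
  assumes \<alpha>: "\<alpha> > -1"
begin

lemma integrable_gbe_power_sum:
  assumes "N > 0"
  shows "integrable (gbe_ht \<alpha> N) (power_sum N p)"
    "integrable (gbe_ht \<alpha> N) (\<lambda>x. power_sum N p x * power_sum N q x)"
    "integrable (gbe_ht \<alpha> N) (\<lambda>x. power_sum N p x * power_sum N q x * power_sum N r x)"
  by (intro integrable_gbe \<alpha> assms poly_bounded_intros)+

lemma covariance_power_sum:
  assumes "N > 0"
  shows "covariance (gbe_ht \<alpha> N) (power_sum N p) (power_sum N q) =
    (\<integral>x. power_sum N p x * power_sum N q x \<partial>gbe_ht \<alpha> N)
    - (\<integral>x. power_sum N p x \<partial>gbe_ht \<alpha> N) * (\<integral>x. power_sum N q x \<partial>gbe_ht \<alpha> N)"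
  using assms by (intro covariance_eq integrable_gbe_power_sum integral_gbe_const \<alpha> integrable_gbe poly_bounded_const)

lemma covariance_power_sum_0:
  assumes "N > 0"
  shows "covariance (gbe_ht \<alpha> N) (power_sum N p) (power_sum N 0) = 0"
  unfolding covariance_power_sum[OF assms] by (simp only: power_sum_0 integral_mult_left_zero integral_gbe_const[OF \<alpha> assms])

text \<open>The choice among q, r, s sits inside the exponent so that the term is literally an
  instance of the family in \<open>large_N_ansatz\<close>.\<close>

abbreviation third_cumulant :: "nat \<Rightarrow> nat \<Rightarrow> nat \<Rightarrow> nat \<Rightarrow> real" where
  "third_cumulant N q r s \<equiv> joint_cumulant (gbe_ht \<alpha> N) {..<3}
     (\<lambda>i::nat. power_sum N (if i = 0 then q else if i = 1 then r else s))"

text \<open>Cumulant inversion with E(S q) E(S r S s) left unexpanded: exactly this product cancels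
  when E(S q) times the equation for the means is subtracted.\<close>

lemma expectation_triple:
  assumes "N > 0"
  shows "(\<integral>x. power_sum N q x * power_sum N r x * power_sum N s x \<partial>gbe_ht \<alpha> N)
    = third_cumulant N q r s
      + (\<integral>x. power_sum N q x \<partial>gbe_ht \<alpha> N) * (\<integral>x. power_sum N r x * power_sum N s x \<partial>gbe_ht \<alpha> N)
      + (\<integral>x. power_sum N r x \<partial>gbe_ht \<alpha> N) * covariance (gbe_ht \<alpha> N) (power_sum N q) (power_sum N s)
      + (\<integral>x. power_sum N s x \<partial>gbe_ht \<alpha> N) * covariance (gbe_ht \<alpha> N) (power_sum N q) (power_sum N r)"
  unfolding joint_cumulant_3 covariance_power_sum[OF assms] by (simp add: algebra_simps)

lemma loop_equation_expectation:
  assumes N: "N > 0"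
  defines "E \<equiv> \<lambda>f. (\<integral>x. f x \<partial>gbe_ht \<alpha> N)"
  shows "E (\<lambda>x. power_sum N q x * power_sum N (p + 1) x) =
     real p * E (\<lambda>x. power_sum N q x * power_sum N (p - 1) x)
     + real q * E (power_sum N (p + (q - 1)))
     + \<alpha> / real N * ((\<Sum>r<p. E (\<lambda>x. power_sum N q x * power_sum N r x * power_sum N (p - 1 - r) x))
         - real p * E (\<lambda>x. power_sum N q x * power_sum N (p - 1) x))"
proof -
  note int = integrable_gbe_power_sum[OF N]
  have "0 = E (\<lambda>x. power_sum N q x * (real p * power_sum N (p - 1) x - power_sum N (p + 1) x)
     + real q * power_sum N (p + (q - 1)) x
     + \<alpha> / real N * power_sum N q x * ((\<Sum>r<p. power_sum N r x * power_sum N (p - 1 - r) x)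
         - real p * power_sum N (p - 1) x))"
    unfolding E_def by (rule loop_equation[OF \<alpha> N, symmetric])
  also have "\<dots> = E (\<lambda>x. real p * (power_sum N q x * power_sum N (p - 1) x)
     - power_sum N q x * power_sum N (p + 1) x
     + real q * power_sum N (p + (q - 1)) x
     + \<alpha> / real N * ((\<Sum>r<p. power_sum N q x * power_sum N r x * power_sum N (p - 1 - r) x)
         - real p * (power_sum N q x * power_sum N (p - 1) x)))"
    by (rule arg_cong[of _ _ E]) (simp add: fun_eq_iff algebra_simps sum_distrib_left)
  also have "\<dots> = real p * E (\<lambda>x. power_sum N q x * power_sum N (p - 1) x)
     - E (\<lambda>x. power_sum N q x * power_sum N (p + 1) x)
     + real q * E (power_sum N (p + (q - 1)))
     + \<alpha> / real N * ((\<Sum>r<p. E (\<lambda>x. power_sum N q x * power_sum N r x * power_sum N (p - 1 - r) x))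
         - real p * E (\<lambda>x. power_sum N q x * power_sum N (p - 1) x))"
    unfolding E_def using int by (simp add: Bochner_Integration.integral_sum)
  finally show ?thesis by simp
qed

lemma loop_equation_mean:
  assumes N: "N > 0"
  defines "E \<equiv> \<lambda>p. (\<integral>x. power_sum N p x \<partial>gbe_ht \<alpha> N)"
  shows "E (p + 1) = real p * E (p - 1)
    + \<alpha> / real N * ((\<Sum>r<p. (\<integral>x. power_sum N r x * power_sum N (p - 1 - r) x \<partial>gbe_ht \<alpha> N)) - real p * E (p - 1))"
proof -
  have "real N * E (p + 1) = real N * (real p * E (p - 1)
    + \<alpha> / real N * ((\<Sum>r<p. (\<integral>x. power_sum N r x * power_sum N (p - 1 - r) x \<partial>gbe_ht \<alpha> N)) - real p * E (p - 1)))"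
    using loop_equation_expectation[OF N, of 0 p] N unfolding E_def
    by (simp add: power_sum_0 mult.assoc algebra_simps sum_distrib_left)
  then show ?thesis using N by simp
qed

lemma loop_equation_covariance:
  assumes N: "N > 0"
  defines "E \<equiv> \<lambda>p. (\<integral>x. power_sum N p x \<partial>gbe_ht \<alpha> N)"
    and "C \<equiv> \<lambda>p q. covariance (gbe_ht \<alpha> N) (power_sum N p) (power_sum N q)"
  shows "C q (p + 1) = real p * C q (p - 1) + real q * E (p + (q - 1))
    + \<alpha> / real N * ((\<Sum>r<p. third_cumulant N q r (p - 1 - r) + E r * C q (p - 1 - r) + E (p - 1 - r) * C q r)
       - real p * C q (p - 1))"
proof -
  define T where "T r = (\<integral>x. power_sum N r x * power_sum N (p - 1 - r) x \<partial>gbe_ht \<alpha> N)" for r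
  have prod: "(\<integral>x. power_sum N q x * power_sum N r x \<partial>gbe_ht \<alpha> N) = C q r + E q * E r" for r
    using covariance_power_sum[OF N] by (simp add: C_def E_def)
  have mean: "E q * E (p + 1) = E q * (real p * E (p - 1) + \<alpha> / real N * ((\<Sum>r<p. T r) - real p * E (p - 1)))"
    using loop_equation_mean[OF N, of p] by (simp add: E_def T_def)
  have "C q (p + 1) + E q * E (p + 1) =
     real p * (C q (p - 1) + E q * E (p - 1)) + real q * E (p + (q - 1))
     + \<alpha> / real N * ((\<Sum>r<p. third_cumulant N q r (p - 1 - r) + E q * T r
          + E r * C q (p - 1 - r) + E (p - 1 - r) * C q r)
         - real p * (C q (p - 1) + E q * E (p - 1)))"
    using loop_equation_expectation[OF N, of q p]
    unfolding expectation_triple[OF N] prod unfolding E_def C_def T_def by simp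
  also have "(\<Sum>r<p. third_cumulant N q r (p - 1 - r) + E q * T r
          + E r * C q (p - 1 - r) + E (p - 1 - r) * C q r)
      = (\<Sum>r<p. third_cumulant N q r (p - 1 - r) + E r * C q (p - 1 - r) + E (p - 1 - r) * C q r) + E q * (\<Sum>r<p. T r)"
    by (simp add: sum.distrib sum_distrib_left)
  finally show ?thesis unfolding mean by (simp add: algebra_simps)
qed

end

section \<open>Recurrences in the large N limit\<close>

context
  fixes \<alpha> :: real
  assumes \<alpha>: "\<alpha> > -1" and ansatz: "large_N_ansatz \<alpha>"
begin

lemma first_order_expansion:
  obtains a b where "(\<lambda>N. scaled_moment \<alpha> p N - (a + b / real N)) \<in> O(\<lambda>N. 1 / real N ^ 2)"
proof -
  obtain c where c: "\<And>L. (\<lambda>N. joint_cumulant (gbe_ht \<alpha> N) {..<1::nat} (\<lambda>i. power_sum N p)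
              - real N * (\<Sum>l<L. c l / real N ^ l)) \<in> O(\<lambda>N. real N * (1 / real N ^ L))"
    using ansatz[unfolded large_N_ansatz_def, rule_format, OF order_refl, of "\<lambda>_. p"] by blast
  have "(\<lambda>N. scaled_moment \<alpha> p N - (c 0 + c 1 / real N)) \<in> O(\<lambda>N. 1 / real N ^ 2)"
  proof -
    have "(\<lambda>N. 1 / real N * ((\<integral>x. power_sum N p x \<partial>gbe_ht \<alpha> N) - real N * (\<Sum>l<2. c l / real N ^ l)))
        \<in> O(\<lambda>N. 1 / real N * (real N * (1 / real N ^ 2)))"
      using c[of 2] unfolding joint_cumulant_1 by (intro landau_o.big.mult_left)
    also have "?this \<longleftrightarrow> ?thesis"
    proof (rule landau_o.big.cong_ex)
      show "eventually (\<lambda>N. 1 / real N * ((\<integral>x. power_sum N p x \<partial>gbe_ht \<alpha> N) - real N * (\<Sum>l<2. c l / real N ^ l))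
          = scaled_moment \<alpha> p N - (c 0 + c 1 / real N)) at_top"
        using eventually_gt_at_top[of 0]
        by eventually_elim (simp add: scaled_moment_def numeral_2_eq_2 field_simps)
      show "eventually (\<lambda>N. 1 / real N * (real N * (1 / real N ^ 2)) = 1 / real N ^ 2) at_top"
        using eventually_gt_at_top[of 0] by eventually_elim simp
    qed
    finally show ?thesis .
  qed
  then show thesis by (rule that)
qed

text \<open>Justifies the definite descriptions: the ansatz gives existence, and uniqueness holds
  because both coefficients are limits.\<close>

lemma mG_expansion:
  "(\<lambda>N. scaled_moment \<alpha> p N - (mG0 \<alpha> p + mG1 \<alpha> p / real N)) \<in> O(\<lambda>N. 1 / real N ^ 2)"
proof -
  obtain a b where ab: "(\<lambda>N. scaled_moment \<alpha> p N - (a + b / real N)) \<in> O(\<lambda>N. 1 / real N ^ 2)"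
    by (rule first_order_expansion)
  have a: "mG0 \<alpha> p = a"
    unfolding mG0_def
  proof (rule the_equality)
    show "\<exists>b. (\<lambda>N. scaled_moment \<alpha> p N - (a + b / real N)) \<in> O(\<lambda>N. 1 / real N ^ 2)" using ab by blast
  next
    fix a' assume "\<exists>b. (\<lambda>N. scaled_moment \<alpha> p N - (a' + b / real N)) \<in> O(\<lambda>N. 1 / real N ^ 2)"
    then obtain b' where "(\<lambda>N. scaled_moment \<alpha> p N - (a' + b' / real N)) \<in> O(\<lambda>N. 1 / real N ^ 2)" ..
    from bigo_first_order_tendsto(2)[OF this] bigo_first_order_tendsto(2)[OF ab]
    show "a' = a" by (rule LIMSEQ_unique)
  qed
  have "mG1 \<alpha> p = b"
    unfolding mG1_def a
    by (rule the_equality)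
       (use ab LIMSEQ_unique[OF bigo_first_order_tendsto(1) bigo_first_order_tendsto(1)[OF ab]] in blast)+
  with a ab show ?thesis by simp
qed

lemmas tendsto_mG1 = bigo_first_order_tendsto(1)[OF mG_expansion]
  and tendsto_mG0 = bigo_first_order_tendsto(2)[OF mG_expansion]

text \<open>With n = 2 and L = 1 the ansatz leaves an error O(1), so the covariance divided by N
  converges and \<open>lim\<close> takes its intended value.\<close>

lemma tendsto_muG0:
  "(\<lambda>N. covariance (gbe_ht \<alpha> N) (power_sum N p) (power_sum N q) / real N) \<longlonglongrightarrow> muG0 \<alpha> p q"
proof -
  obtain c where c: "\<And>L. (\<lambda>N. joint_cumulant (gbe_ht \<alpha> N) {..<2} (\<lambda>i::nat. power_sum N (if i = 0 then p else q))
              - real N * (\<Sum>l<L. c l / real N ^ l)) \<in> O(\<lambda>N. real N * (1 / real N ^ L))"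
    using ansatz[unfolded large_N_ansatz_def, rule_format, of 2 "\<lambda>i. if i = 0 then p else q"] by auto
  obtain K where K: "eventually (\<lambda>N. norm (joint_cumulant (gbe_ht \<alpha> N) {..<2} (\<lambda>i::nat. power_sum N (if i = 0 then p else q))
              - real N * (\<Sum>l<1. c l / real N ^ l)) \<le> K * norm (real N * (1 / real N ^ 1))) at_top"
    by (rule landau_o.bigE[OF c[of 1]]) blast
  have "(\<lambda>N. covariance (gbe_ht \<alpha> N) (power_sum N p) (power_sum N q) / real N - c 0) \<longlonglongrightarrow> 0"
  proof (rule Lim_null_comparison)
    show "eventually (\<lambda>N. norm (covariance (gbe_ht \<alpha> N) (power_sum N p) (power_sum N q) / real N - c 0) \<le> K / real N) at_top"
      using K eventually_gt_at_top[of 0]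
    proof eventually_elim
      case (elim N)
      have "norm (covariance (gbe_ht \<alpha> N) (power_sum N p) (power_sum N q) - real N * c 0) \<le> K"
        using elim by (simp add: joint_cumulant_2 covariance_power_sum[OF \<alpha>])
      moreover have "covariance (gbe_ht \<alpha> N) (power_sum N p) (power_sum N q) / real N - c 0
          = (covariance (gbe_ht \<alpha> N) (power_sum N p) (power_sum N q) - real N * c 0) / real N"
        using elim by (simp add: field_simps)
      ultimately show ?case by (simp add: abs_divide divide_right_mono)
    qed
    show "(\<lambda>N. K / real N) \<longlonglongrightarrow> 0" by real_asymp
  qed
  then have "(\<lambda>N. covariance (gbe_ht \<alpha> N) (power_sum N p) (power_sum N q) / real N) \<longlonglongrightarrow> c 0"
    by (simp add: LIM_zero_iff)
  then show ?thesis unfolding muG0_def by (simp add: limI)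
qed

text \<open>With L = 0 the ansatz says that the cumulant is O(N). One factor 1/N is the prefactor
  \<alpha>/N of the loop equation, the other comes from dividing the covariance by N.\<close>

lemma tendsto_third_cumulant:
  "(\<lambda>N. third_cumulant \<alpha> N q r s / (real N)\<^sup>2) \<longlonglongrightarrow> 0"
proof -
  obtain c where c: "\<And>L. (\<lambda>N. third_cumulant \<alpha> N q r s
              - real N * (\<Sum>l<L. c l / real N ^ l)) \<in> O(\<lambda>N. real N * (1 / real N ^ L))"
    using ansatz[unfolded large_N_ansatz_def, rule_format, of 3 "\<lambda>i. if i = 0 then q else if i = 1 then r else s"] by auto
  obtain K where K: "eventually (\<lambda>N. norm (third_cumulant \<alpha> N q r s
              - real N * (\<Sum>l<0. c l / real N ^ l)) \<le> K * norm (real N * (1 / real N ^ 0))) at_top"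
    by (rule landau_o.bigE[OF c[of 0]]) blast
  show ?thesis
  proof (rule Lim_null_comparison)
    show "eventually (\<lambda>N. norm (third_cumulant \<alpha> N q r s / (real N)\<^sup>2) \<le> K / real N) at_top"
      using K eventually_gt_at_top[of 0]
    proof eventually_elim
      case (elim N)
      then have "norm (third_cumulant \<alpha> N q r s) \<le> K * real N" by simp
      then have "norm (third_cumulant \<alpha> N q r s) / (real N)\<^sup>2 \<le> K * real N / (real N)\<^sup>2"
        by (intro divide_right_mono) auto
      then show ?case using elim by (simp add: power2_eq_square)
    qed
    show "(\<lambda>N. K / real N) \<longlonglongrightarrow> 0" by real_asymp
  qed
qed

text \<open>The covariance carries an additional 1/N against the product of means: it is invisible
  at leading order and becomes the summed covariance in the first correction.\<close>

lemma scaled_loop_equation_mean: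
  assumes N: "N > 0"
  shows "scaled_moment \<alpha> (p + 1) N = real p * scaled_moment \<alpha> (p - 1) N
    + \<alpha> * (\<Sum>r<p. covariance (gbe_ht \<alpha> N) (power_sum N r) (power_sum N (p - 1 - r)) / real N * (1 / real N)
        + scaled_moment \<alpha> r N * scaled_moment \<alpha> (p - 1 - r) N)
    - \<alpha> * real p * (scaled_moment \<alpha> (p - 1) N * (1 / real N))"
proof -
  have term_eq: "(\<integral>x. power_sum N r x * power_sum N s x \<partial>gbe_ht \<alpha> N)
      = real N * real N * (covariance (gbe_ht \<alpha> N) (power_sum N r) (power_sum N s) / real N * (1 / real N)
        + scaled_moment \<alpha> r N * scaled_moment \<alpha> s N)" for r s
    unfolding covariance_power_sum[OF \<alpha> N] scaled_moment_def using N by (simp add: field_simps)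
  define S where "S = (\<Sum>r<p. covariance (gbe_ht \<alpha> N) (power_sum N r) (power_sum N (p - 1 - r)) / real N * (1 / real N)
        + scaled_moment \<alpha> r N * scaled_moment \<alpha> (p - 1 - r) N)"
  have "(\<integral>x. power_sum N (p + 1) x \<partial>gbe_ht \<alpha> N) = real p * (\<integral>x. power_sum N (p - 1) x \<partial>gbe_ht \<alpha> N)
      + \<alpha> / real N * (real N * real N * S - real p * (\<integral>x. power_sum N (p - 1) x \<partial>gbe_ht \<alpha> N))"
    using loop_equation_mean[OF \<alpha> N, of p] unfolding term_eq sum_distrib_left[symmetric] S_def .
  note mean = this
  show ?thesis
    unfolding S_def[symmetric] unfolding scaled_moment_def unfolding mean using N by (simp add: field_simps)
qed

lemma scaled_loop_equation_covariance:
  assumes N: "N > 0"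
  defines "C \<equiv> \<lambda>p q. covariance (gbe_ht \<alpha> N) (power_sum N p) (power_sum N q) / real N"
  shows "C q (p + 1) = real p * C q (p - 1) + real q * scaled_moment \<alpha> (p + (q - 1)) N
    + \<alpha> * (\<Sum>r<p. third_cumulant \<alpha> N q r (p - 1 - r) / (real N)\<^sup>2
        + scaled_moment \<alpha> r N * C q (p - 1 - r) + scaled_moment \<alpha> (p - 1 - r) N * C q r)
    - \<alpha> * real p * (C q (p - 1) * (1 / real N))"
proof -
  have "(\<Sum>r<p. third_cumulant \<alpha> N q r (p - 1 - r) / (real N)\<^sup>2
        + scaled_moment \<alpha> r N * C q (p - 1 - r) + scaled_moment \<alpha> (p - 1 - r) N * C q r)
     = (\<Sum>r<p. third_cumulant \<alpha> N q r (p - 1 - r)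
        + (\<integral>x. power_sum N r x \<partial>gbe_ht \<alpha> N) * covariance (gbe_ht \<alpha> N) (power_sum N q) (power_sum N (p - 1 - r))
        + (\<integral>x. power_sum N (p - 1 - r) x \<partial>gbe_ht \<alpha> N) * covariance (gbe_ht \<alpha> N) (power_sum N q) (power_sum N r))
        / (real N)\<^sup>2"
    unfolding sum_divide_distrib C_def scaled_moment_def
    using N by (intro sum.cong refl) (simp add: power2_eq_square add_divide_distrib)
  then show ?thesis
    using N unfolding C_def loop_equation_covariance[OF \<alpha> N, of q p]
    by (simp add: scaled_moment_def power2_eq_square field_simps)
qed

section \<open>Loop equations for the limiting coefficients\<close>

lemma mG0_loop:
  "mG0 \<alpha> (p + 1) = real p * mG0 \<alpha> (p - 1) + \<alpha> * (\<Sum>r<p. mG0 \<alpha> r * mG0 \<alpha> (p - 1 - r))"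
proof -
  define rhs where "rhs N = real p * scaled_moment \<alpha> (p - 1) N
    + \<alpha> * (\<Sum>r<p. covariance (gbe_ht \<alpha> N) (power_sum N r) (power_sum N (p - 1 - r)) / real N * (1 / real N)
        + scaled_moment \<alpha> r N * scaled_moment \<alpha> (p - 1 - r) N)
    - \<alpha> * real p * (scaled_moment \<alpha> (p - 1) N * (1 / real N))" for N
  have "rhs \<longlonglongrightarrow> real p * mG0 \<alpha> (p - 1) + \<alpha> * (\<Sum>r<p. muG0 \<alpha> r (p - 1 - r) * 0 + mG0 \<alpha> r * mG0 \<alpha> (p - 1 - r))
      - \<alpha> * real p * (mG0 \<alpha> (p - 1) * 0)"
    unfolding rhs_def
    by (intro tendsto_add tendsto_diff tendsto_mult tendsto_sum tendsto_const tendsto_mG0 tendsto_muG0 lim_1_over_n)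
  moreover have "eventually (\<lambda>N. scaled_moment \<alpha> (p + 1) N = rhs N) at_top"
    using eventually_gt_at_top[of 0] by eventually_elim (unfold rhs_def, rule scaled_loop_equation_mean)
  ultimately have "scaled_moment \<alpha> (p + 1) \<longlonglongrightarrow> real p * mG0 \<alpha> (p - 1) + \<alpha> * (\<Sum>r<p. mG0 \<alpha> r * mG0 \<alpha> (p - 1 - r))"
    by (simp add: tendsto_cong)
  with tendsto_mG0[of "p + 1"] show ?thesis by (rule LIMSEQ_unique)
qed

text \<open>The leading equation is subtracted from the exact one and the difference multiplied by
  N. Products are handled by M_r M_s - m_r m_s = (M_r - m_r) M_s + m_r (M_s - m_s), so only
  convergent sequences are multiplied.\<close>

lemma mG1_loop:
  "mG1 \<alpha> (p + 1) = real p * mG1 \<alpha> (p - 1)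
    + \<alpha> * (\<Sum>r<p. muG0 \<alpha> r (p - 1 - r) + (mG1 \<alpha> r * mG0 \<alpha> (p - 1 - r) + mG0 \<alpha> r * mG1 \<alpha> (p - 1 - r)))
    - \<alpha> * real p * mG0 \<alpha> (p - 1)"
proof -
  define M where "M q N = scaled_moment \<alpha> q N" for q N
  define D where "D q N = real N * (M q N - mG0 \<alpha> q)" for q N
  define C where "C r s N = covariance (gbe_ht \<alpha> N) (power_sum N r) (power_sum N s) / real N" for r s N
  define rhs where "rhs N = real p * D (p - 1) N
    + \<alpha> * (\<Sum>r<p. C r (p - 1 - r) N + (D r N * M (p - 1 - r) N + mG0 \<alpha> r * D (p - 1 - r) N))
    - \<alpha> * real p * M (p - 1) N" for N
  have lims: "M q \<longlonglongrightarrow> mG0 \<alpha> q" "D q \<longlonglongrightarrow> mG1 \<alpha> q" "C q r \<longlonglongrightarrow> muG0 \<alpha> q r" for q r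
    unfolding M_def[abs_def] D_def[abs_def] C_def[abs_def] by (rule tendsto_mG0 tendsto_mG1 tendsto_muG0)+
  have "rhs \<longlonglongrightarrow> real p * mG1 \<alpha> (p - 1)
    + \<alpha> * (\<Sum>r<p. muG0 \<alpha> r (p - 1 - r) + (mG1 \<alpha> r * mG0 \<alpha> (p - 1 - r) + mG0 \<alpha> r * mG1 \<alpha> (p - 1 - r)))
    - \<alpha> * real p * mG0 \<alpha> (p - 1)"
    unfolding rhs_def by (intro tendsto_add tendsto_diff tendsto_mult tendsto_sum tendsto_const lims)
  moreover have "eventually (\<lambda>N. D (p + 1) N = rhs N) at_top"
    using eventually_gt_at_top[of 0]
  proof eventually_elim
    case (elim N)
    have "D (p + 1) N = real N * ((real p * M (p - 1) N
      + \<alpha> * (\<Sum>r<p. C r (p - 1 - r) N * (1 / real N) + M r N * M (p - 1 - r) N)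
      - \<alpha> * real p * (M (p - 1) N * (1 / real N)))
      - (real p * mG0 \<alpha> (p - 1) + \<alpha> * (\<Sum>r<p. mG0 \<alpha> r * mG0 \<alpha> (p - 1 - r))))"
      unfolding D_def M_def C_def scaled_loop_equation_mean[OF elim, of p] mG0_loop[of p] ..
    also have "\<dots> = real p * D (p - 1) N
      + \<alpha> * (\<Sum>r<p. real N * (C r (p - 1 - r) N * (1 / real N) + M r N * M (p - 1 - r) N - mG0 \<alpha> r * mG0 \<alpha> (p - 1 - r)))
      - \<alpha> * real p * M (p - 1) N"
      unfolding sum_distrib_left[symmetric] sum_subtractf D_def using elim by (simp add: field_simps)
    also have "(\<Sum>r<p. real N * (C r (p - 1 - r) N * (1 / real N) + M r N * M (p - 1 - r) N - mG0 \<alpha> r * mG0 \<alpha> (p - 1 - r)))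
       = (\<Sum>r<p. C r (p - 1 - r) N + (D r N * M (p - 1 - r) N + mG0 \<alpha> r * D (p - 1 - r) N))"
      using elim by (intro sum.cong refl) (simp add: D_def field_simps)
    finally show ?case unfolding rhs_def .
  qed
  ultimately have "D (p + 1) \<longlonglongrightarrow> real p * mG1 \<alpha> (p - 1)
    + \<alpha> * (\<Sum>r<p. muG0 \<alpha> r (p - 1 - r) + (mG1 \<alpha> r * mG0 \<alpha> (p - 1 - r) + mG0 \<alpha> r * mG1 \<alpha> (p - 1 - r)))
    - \<alpha> * real p * mG0 \<alpha> (p - 1)"
    by (simp add: tendsto_cong)
  with lims(2)[of "p + 1"] show ?thesis by (rule LIMSEQ_unique)
qed

lemma muG0_loop:
  "muG0 \<alpha> q (p + 1) = real p * muG0 \<alpha> q (p - 1) + real q * mG0 \<alpha> (p + (q - 1))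
    + \<alpha> * (\<Sum>r<p. mG0 \<alpha> r * muG0 \<alpha> q (p - 1 - r) + mG0 \<alpha> (p - 1 - r) * muG0 \<alpha> q r)"
proof -
  define C where "C r s N = covariance (gbe_ht \<alpha> N) (power_sum N r) (power_sum N s) / real N" for r s N
  have C: "C r s \<longlonglongrightarrow> muG0 \<alpha> r s" for r s
    unfolding C_def[abs_def] by (rule tendsto_muG0)
  define rhs where "rhs N = real p * C q (p - 1) N + real q * scaled_moment \<alpha> (p + (q - 1)) N
    + \<alpha> * (\<Sum>r<p. third_cumulant \<alpha> N q r (p - 1 - r) / (real N)\<^sup>2
        + scaled_moment \<alpha> r N * C q (p - 1 - r) N + scaled_moment \<alpha> (p - 1 - r) N * C q r N)
    - \<alpha> * real p * (C q (p - 1) N * (1 / real N))" for N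
  have "rhs \<longlonglongrightarrow> real p * muG0 \<alpha> q (p - 1) + real q * mG0 \<alpha> (p + (q - 1))
    + \<alpha> * (\<Sum>r<p. 0 + mG0 \<alpha> r * muG0 \<alpha> q (p - 1 - r) + mG0 \<alpha> (p - 1 - r) * muG0 \<alpha> q r)
    - \<alpha> * real p * (muG0 \<alpha> q (p - 1) * 0)"
    unfolding rhs_def
    by (intro tendsto_add tendsto_diff tendsto_mult tendsto_sum tendsto_const C tendsto_mG0 tendsto_third_cumulant lim_1_over_n)
  moreover have "eventually (\<lambda>N. C q (p + 1) N = rhs N) at_top"
    using eventually_gt_at_top[of 0]
    by eventually_elim (unfold rhs_def C_def, rule scaled_loop_equation_covariance)
  ultimately have "C q (p + 1) \<longlonglongrightarrow> real p * muG0 \<alpha> q (p - 1) + real q * mG0 \<alpha> (p + (q - 1))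
    + \<alpha> * (\<Sum>r<p. mG0 \<alpha> r * muG0 \<alpha> q (p - 1 - r) + mG0 \<alpha> (p - 1 - r) * muG0 \<alpha> q r)"
    by (simp add: tendsto_cong)
  with C show ?thesis by (rule LIMSEQ_unique)
qed

section \<open>Initial values, parity and even indices\<close>

lemma muG0_commute: "muG0 \<alpha> p q = muG0 \<alpha> q p"
  unfolding muG0_def by (subst covariance_power_sum_commute) (rule refl)

lemma muG0_0: "muG0 \<alpha> q 0 = 0"
proof -
  have "eventually (\<lambda>N. covariance (gbe_ht \<alpha> N) (power_sum N q) (power_sum N 0) / real N = 0) at_top"
    using eventually_gt_at_top[of 0] by eventually_elim (simp add: covariance_power_sum_0 \<alpha>)
  then have "(\<lambda>N. covariance (gbe_ht \<alpha> N) (power_sum N q) (power_sum N 0) / real N) \<longlonglongrightarrow> 0"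
    by (rule tendsto_eventually)
  with tendsto_muG0 show ?thesis by (rule LIMSEQ_unique)
qed

lemma scaled_moment_0: "N > 0 \<Longrightarrow> scaled_moment \<alpha> 0 N = 1"
  by (simp only: scaled_moment_def power_sum_0 integral_gbe_const[OF \<alpha>]) simp

lemma mG0_0: "mG0 \<alpha> 0 = 1"
proof -
  have "eventually (\<lambda>N. scaled_moment \<alpha> 0 N = 1) at_top"
    using eventually_gt_at_top[of 0] by eventually_elim (rule scaled_moment_0)
  then have "scaled_moment \<alpha> 0 \<longlonglongrightarrow> 1" by (rule tendsto_eventually)
  with tendsto_mG0 show ?thesis by (rule LIMSEQ_unique)
qed

lemma mG1_0: "mG1 \<alpha> 0 = 0"
proof -
  have "eventually (\<lambda>N. real N * (scaled_moment \<alpha> 0 N - mG0 \<alpha> 0) = 0) at_top"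
    using eventually_gt_at_top[of 0] by eventually_elim (simp add: scaled_moment_0 mG0_0)
  then have "(\<lambda>N. real N * (scaled_moment \<alpha> 0 N - mG0 \<alpha> 0)) \<longlonglongrightarrow> 0" by (rule tendsto_eventually)
  with tendsto_mG1 show ?thesis by (rule LIMSEQ_unique)
qed

lemma mG0_odd: "mG0 \<alpha> (2 * n + 1) = 0"
proof (induction n rule: less_induct)
  case (less n)
  have "mG0 \<alpha> (2 * n + 1) = real (2 * n) * mG0 \<alpha> (2 * n - 1) + \<alpha> * (\<Sum>r<2 * n. mG0 \<alpha> r * mG0 \<alpha> (2 * n - 1 - r))"
    by (rule mG0_loop)
  moreover
  have odd: "mG0 \<alpha> k = 0" if "odd k" "k < 2 * n" for k
    using that less by (auto elim!: oddE)
  \<comment> \<open>The two indices add up to the odd number 2n - 1, so one of them is odd and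
    covered by the induction hypothesis.\<close>
  have "mG0 \<alpha> r * mG0 \<alpha> (2 * n - 1 - r) = 0" if "r < 2 * n" for r
    using that odd[of r] odd[of "2 * n - 1 - r"] by (cases "even r") auto
  then have "(\<Sum>r<2 * n. mG0 \<alpha> r * mG0 \<alpha> (2 * n - 1 - r)) = 0"
    by (intro sum.neutral) auto
  \<comment> \<open>For n = 0 the truncated index is 0, where the moment is 1; the coefficient 2n
    makes the term vanish.\<close>
  moreover have "real (2 * n) * mG0 \<alpha> (2 * n - 1) = 0"
    using odd[of "2 * n - 1"] by (cases "n = 0") auto
  ultimately show ?case by (simp only: mult_zero_right add_0)
qed

lemma mG0_even:
  "mG0 \<alpha> (2 * p + 2) = (2 * real p + 1) * mG0 \<alpha> (2 * p) + \<alpha> * (\<Sum>s\<le>p. mG0 \<alpha> (2 * p - 2 * s) * mG0 \<alpha> (2 * s))"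
proof -
  have "(\<Sum>r\<le>2 * p. mG0 \<alpha> r * mG0 \<alpha> (2 * p - r)) = (\<Sum>s\<le>p. mG0 \<alpha> (2 * s) * mG0 \<alpha> (2 * p - 2 * s))"
    using mG0_odd by (intro sum_atMost_even) simp
  then show ?thesis
    using mG0_loop[of "2 * p + 1"] by (simp add: lessThan_Suc_atMost mult.commute add.commute)
qed

text \<open>In each mixed product the leading moment alone removes the odd indices, since the
  indices add up to 2p. The two mixed sums agree by reflection, hence the factor 2, and the summand
  s = p drops out because of \<open>mG1_0\<close>.\<close>

lemma mG1_even:
  "mG1 \<alpha> (2 * (p + 1)) =
        - \<alpha> * (2 * real p + 1) * mG0 \<alpha> (2 * p) + (2 * real p + 1) * mG1 \<alpha> (2 * p)
        + \<alpha> * mu_tildeG0 \<alpha> (2 * p)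
        + 2 * \<alpha> * (\<Sum>s<p. mG0 \<alpha> (2 * s) * mG1 \<alpha> (2 * (p - s)))"
proof -
  have "(\<Sum>r\<le>2 * p. mG0 \<alpha> r * mG1 \<alpha> (2 * p - r)) = (\<Sum>s\<le>p. mG0 \<alpha> (2 * s) * mG1 \<alpha> (2 * p - 2 * s))"
    using mG0_odd by (intro sum_atMost_even) simp
  also have "\<dots> = (\<Sum>s<p. mG0 \<alpha> (2 * s) * mG1 \<alpha> (2 * (p - s)))"
    by (simp add: mG1_0 diff_mult_distrib2 flip: lessThan_Suc_atMost)
  finally have even: "(\<Sum>r\<le>2 * p. mG0 \<alpha> r * mG1 \<alpha> (2 * p - r)) = (\<Sum>s<p. mG0 \<alpha> (2 * s) * mG1 \<alpha> (2 * (p - s)))" .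
  have "(\<Sum>r\<le>2 * p. mG1 \<alpha> r * mG0 \<alpha> (2 * p - r)) = (\<Sum>r\<le>2 * p. mG1 \<alpha> (2 * p - r) * mG0 \<alpha> r)"
    by (rule sum_atMost_reflect)
  also have "\<dots> = (\<Sum>r\<le>2 * p. mG0 \<alpha> r * mG1 \<alpha> (2 * p - r))"
    by (simp add: mult.commute)
  finally have "(\<Sum>r\<le>2 * p. muG0 \<alpha> r (2 * p - r) + (mG1 \<alpha> r * mG0 \<alpha> (2 * p - r) + mG0 \<alpha> r * mG1 \<alpha> (2 * p - r)))
      = mu_tildeG0 \<alpha> (2 * p) + 2 * (\<Sum>s<p. mG0 \<alpha> (2 * s) * mG1 \<alpha> (2 * (p - s)))"
    by (simp add: sum.distrib even mu_tildeG0_def)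
  then show ?thesis
    using mG1_loop[of "2 * p + 1"] by (simp add: lessThan_Suc_atMost algebra_simps)
qed

lemma mu_tildeG0_0: "mu_tildeG0 \<alpha> 0 = 0"
  by (simp add: mu_tildeG0_def muG0_0)

text \<open>Reflecting i to m - i and using symmetry of the covariance exchanges the weights m - i +
  1 and i + 1, whose sum m + 2 is constant. For m = 2p this is the coefficient p + 1 in the
  recurrence.\<close>

lemma sum_weighted_muG0:
  "(\<Sum>i\<le>m. real (m - i + 1) * muG0 \<alpha> i (m - i)) = (real m / 2 + 1) * mu_tildeG0 \<alpha> m"
proof -
  define S where "S = (\<Sum>i\<le>m. real (m - i + 1) * muG0 \<alpha> i (m - i))"
  have "S = (\<Sum>i\<le>m. real (i + 1) * muG0 \<alpha> i (m - i))"
    unfolding S_def using sum_atMost_reflect[of "\<lambda>i j. real (j + 1) * muG0 \<alpha> i j" m] by (simp add: muG0_commute)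
  then have "2 * S = (\<Sum>i\<le>m. real (m - i + 1) * muG0 \<alpha> i (m - i) + real (i + 1) * muG0 \<alpha> i (m - i))"
    unfolding sum.distrib by (simp add: S_def)
  also have "\<dots> = (\<Sum>i\<le>m. (real m + 2) * muG0 \<alpha> i (m - i))"
    by (intro sum.cong refl) (auto simp: of_nat_diff algebra_simps)
  also have "\<dots> = (real m + 2) * mu_tildeG0 \<alpha> m"
    by (simp add: mu_tildeG0_def sum_distrib_left)
  finally show ?thesis by (simp add: S_def field_simps)
qed

lemma muG0_loop':
  assumes "i \<le> m"
  shows "muG0 \<alpha> i (m + 2 - i) = real (m - i + 1) * muG0 \<alpha> i (m - i) + real i * mG0 \<alpha> m
    + 2 * \<alpha> * (\<Sum>r\<le>m - i. mG0 \<alpha> r * muG0 \<alpha> i (m - i - r))"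
proof -
  have reflect: "(\<Sum>r\<le>m - i. mG0 \<alpha> (m - i - r) * muG0 \<alpha> i r) = (\<Sum>r\<le>m - i. mG0 \<alpha> r * muG0 \<alpha> i (m - i - r))"
    by (rule sum_atMost_reflect[symmetric])
  \<comment> \<open>At i = 0 truncation raises the index to m + 1, but the coefficient is 0.\<close>
  have degree: "real i * mG0 \<alpha> (m - i + 1 + (i - 1)) = real i * mG0 \<alpha> m"
    using assms by (cases i) auto
  have index: "m + 2 - i = m - i + 1 + 1" using assms by simp
  have "muG0 \<alpha> i (m - i + 1 + 1) = real (m - i + 1) * muG0 \<alpha> i (m - i) + real i * mG0 \<alpha> (m - i + 1 + (i - 1))
      + \<alpha> * (\<Sum>r\<le>m - i. mG0 \<alpha> r * muG0 \<alpha> i (m - i - r) + mG0 \<alpha> (m - i - r) * muG0 \<alpha> i r)"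
    using muG0_loop[of i "m - i + 1"] by (simp add: lessThan_Suc_atMost)
  then show ?thesis unfolding index degree sum.distrib reflect by simp
qed

lemma mu_tildeG0_even:
  "mu_tildeG0 \<alpha> (2 * p + 2) =
        (real p + 1) * mu_tildeG0 \<alpha> (2 * p)
        + (2 * real p + 1) * (real p + 1) * mG0 \<alpha> (2 * p)
        + 2 * \<alpha> * (\<Sum>l=1..p. mu_tildeG0 \<alpha> (2 * l) * mG0 \<alpha> (2 * (p - l)))"
proof -
  define m where "m = 2 * p"
  \<comment> \<open>Exchanging the order of summation collects, for each r, all covariances of total
    degree m - r into one \<open>mu_tildeG0\<close>.\<close>
  have "(\<Sum>i\<le>m. \<Sum>r\<le>m - i. mG0 \<alpha> r * muG0 \<alpha> i (m - i - r))
      = (\<Sum>r\<le>m. \<Sum>i\<le>m - r. mG0 \<alpha> r * muG0 \<alpha> i (m - r - i))"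
    by (subst sum_triangle_swap) (simp add: diff_right_commute add.commute)
  also have "\<dots> = (\<Sum>r\<le>2 * p. mG0 \<alpha> r * mu_tildeG0 \<alpha> (2 * p - r))"
    by (simp add: m_def mu_tildeG0_def sum_distrib_left)
  also have "\<dots> = (\<Sum>s\<le>p. mG0 \<alpha> (2 * s) * mu_tildeG0 \<alpha> (2 * p - 2 * s))"
    using mG0_odd by (intro sum_atMost_even) simp
  also have "\<dots> = (\<Sum>s\<le>p. mG0 \<alpha> (2 * s) * mu_tildeG0 \<alpha> (2 * (p - s)))"
    by (simp add: diff_mult_distrib2)
  also have "\<dots> = (\<Sum>l\<le>p. mG0 \<alpha> (2 * (p - l)) * mu_tildeG0 \<alpha> (2 * l))"
    by (rule sum_atMost_reflect)
  also have "\<dots> = (\<Sum>l=1..p. mu_tildeG0 \<alpha> (2 * l) * mG0 \<alpha> (2 * (p - l)))"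
    by (simp add: atMost_atLeast0 sum.atLeast_Suc_atMost mu_tildeG0_0 mult.commute)
  finally have conv: "(\<Sum>i\<le>m. \<Sum>r\<le>m - i. mG0 \<alpha> r * muG0 \<alpha> i (m - i - r))
      = (\<Sum>l=1..p. mu_tildeG0 \<alpha> (2 * l) * mG0 \<alpha> (2 * (p - l)))" .
  have gauss: "(\<Sum>i\<le>m. real i) = real p * (2 * real p + 1)"
    unfolding m_def by (induction p) (auto simp: algebra_simps)
  \<comment> \<open>The last two summands lie outside the range of \<open>muG0_loop'\<close>. The
    one at i = m + 1 contributes 2p + 1 to the coefficient of \<open>mG0 \<alpha> m\<close>;
    together with p(2p + 1) from the sum of the i this makes (2p + 1)(p + 1).\<close>
  have "mu_tildeG0 \<alpha> (m + 2) = (\<Sum>i\<le>m. muG0 \<alpha> i (m + 2 - i)) + muG0 \<alpha> (m + 1) 1 + muG0 \<alpha> (m + 2) 0"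
    by (simp add: mu_tildeG0_def)
  also have "muG0 \<alpha> (m + 2) 0 = 0" by (rule muG0_0)
  also have "muG0 \<alpha> (m + 1) 1 = real (m + 1) * mG0 \<alpha> m"
    using muG0_loop[of "m + 1" 0] by simp
  also have "(\<Sum>i\<le>m. muG0 \<alpha> i (m + 2 - i)) = (\<Sum>i\<le>m. real (m - i + 1) * muG0 \<alpha> i (m - i) + real i * mG0 \<alpha> m
    + 2 * \<alpha> * (\<Sum>r\<le>m - i. mG0 \<alpha> r * muG0 \<alpha> i (m - i - r)))"
    by (intro sum.cong refl muG0_loop') auto
  also have "\<dots> = (real m / 2 + 1) * mu_tildeG0 \<alpha> m + (\<Sum>i\<le>m. real i) * mG0 \<alpha> m
    + 2 * \<alpha> * (\<Sum>l=1..p. mu_tildeG0 \<alpha> (2 * l) * mG0 \<alpha> (2 * (p - l)))"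
    by (simp only: sum.distrib sum_weighted_muG0 conv sum_distrib_left[symmetric] sum_distrib_right[symmetric])
  finally show ?thesis
    unfolding gauss by (simp add: m_def algebra_simps)
qed

end

theorem proposition1p3:
  fixes \<alpha> :: real
  assumes "\<alpha> > -1" and "large_N_ansatz \<alpha>"
  shows
    "(\<forall>p. mG1 \<alpha> (2 * (p + 1)) =
        - \<alpha> * (2 * real p + 1) * mG0 \<alpha> (2 * p) + (2 * real p + 1) * mG1 \<alpha> (2 * p)
        + \<alpha> * mu_tildeG0 \<alpha> (2 * p)
        + 2 * \<alpha> * (\<Sum>s<p. mG0 \<alpha> (2 * s) * mG1 \<alpha> (2 * (p - s))))
     \<and> mG1 \<alpha> 0 = 0
     \<and> (\<forall>p. mG0 \<alpha> (2 * p + 2) =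
        (2 * real p + 1) * mG0 \<alpha> (2 * p)
        + \<alpha> * (\<Sum>s\<le>p. mG0 \<alpha> (2 * p - 2 * s) * mG0 \<alpha> (2 * s)))
     \<and> mG0 \<alpha> 0 = 1
     \<and> (\<forall>p. mu_tildeG0 \<alpha> (2 * p + 2) =
        (real p + 1) * mu_tildeG0 \<alpha> (2 * p)
        + (2 * real p + 1) * (real p + 1) * mG0 \<alpha> (2 * p)
        + 2 * \<alpha> * (\<Sum>l=1..p. mu_tildeG0 \<alpha> (2 * l) * mG0 \<alpha> (2 * (p - l))))
     \<and> mu_tildeG0 \<alpha> 0 = 0
     \<and> (\<forall>f :: nat \<Rightarrow> real.
          f 0 = 1 \<and>
          (\<forall>p. f (p + 1) = (2 * real p + 1) * f p + \<alpha> * (\<Sum>s\<le>p. f (p - s) * f s))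
          \<longrightarrow> (\<forall>p. f p = mG0 \<alpha> (2 * p)))
     \<and> (\<forall>g :: nat \<Rightarrow> real.
          g 0 = 0 \<and>
          (\<forall>p. g (p + 1) = (real p + 1) * g p + (2 * real p + 1) * (real p + 1) * mG0 \<alpha> (2 * p)
             + 2 * \<alpha> * (\<Sum>l=1..p. g l * mG0 \<alpha> (2 * (p - l))))
          \<longrightarrow> (\<forall>p. g p = mu_tildeG0 \<alpha> (2 * p)))"
proof (intro conjI allI impI)
  \<comment> \<open>This and the next case are the formal content of \<open>determined by\<close>:
    the right side at p + 1 involves only values at indices up to p, so strong induction gives
    uniqueness.\<close>
  fix f :: "nat \<Rightarrow> real" and p
  assume f: "f 0 = 1 \<and> (\<forall>p. f (p + 1) = (2 * real p + 1) * f p + \<alpha> * (\<Sum>s\<le>p. f (p - s) * f s))"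
  show "f p = mG0 \<alpha> (2 * p)"
  proof (induction p rule: less_induct)
    case (less p)
    show ?case
    proof (cases p)
      case 0
      then show ?thesis using f mG0_0[OF assms] by simp
    next
      case (Suc n)
      have "(\<Sum>s\<le>n. f (n - s) * f s) = (\<Sum>s\<le>n. mG0 \<alpha> (2 * n - 2 * s) * mG0 \<alpha> (2 * s))"
        using less Suc by (intro sum.cong) (auto simp: diff_mult_distrib2)
      moreover have "f n = mG0 \<alpha> (2 * n)" using less Suc by simp
      moreover have "f p = (2 * real n + 1) * f n + \<alpha> * (\<Sum>s\<le>n. f (n - s) * f s)"
        using f Suc by simp
      ultimately show ?thesis using mG0_even[OF assms, of n] Suc by simp
    qed
  qed
next
  fix g :: "nat \<Rightarrow> real" and p
  assume g: "g 0 = 0 \<and> (\<forall>p. g (p + 1) = (real p + 1) * g p + (2 * real p + 1) * (real p + 1) * mG0 \<alpha> (2 * p)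
             + 2 * \<alpha> * (\<Sum>l=1..p. g l * mG0 \<alpha> (2 * (p - l))))"
  show "g p = mu_tildeG0 \<alpha> (2 * p)"
  proof (induction p rule: less_induct)
    case (less p)
    show ?case
    proof (cases p)
      case 0
      then show ?thesis using g mu_tildeG0_0[OF assms] by simp
    next
      case (Suc n)
      have "(\<Sum>l=1..n. g l * mG0 \<alpha> (2 * (n - l))) = (\<Sum>l=1..n. mu_tildeG0 \<alpha> (2 * l) * mG0 \<alpha> (2 * (n - l)))"
        using less Suc by (intro sum.cong) auto
      moreover have "g n = mu_tildeG0 \<alpha> (2 * n)" using less Suc by simp
      moreover have "g p = (real n + 1) * g n + (2 * real n + 1) * (real n + 1) * mG0 \<alpha> (2 * n)
             + 2 * \<alpha> * (\<Sum>l=1..n. g l * mG0 \<alpha> (2 * (n - l)))"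
        using g Suc by simp
      ultimately show ?thesis using mu_tildeG0_even[OF assms, of n] Suc by simp
    qed
  qed
qed (rule mG1_even mG1_0 mG0_even mG0_0 mu_tildeG0_even mu_tildeG0_0; fact assms)+

end
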